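(* Fix $\gamma\in(0,1)$ and set $n=\lfloor\gamma N\rfloor$, $u_\ast(\gamma)=2\sqrt{\gamma(1-\gamma)}$. Let $0<|u|<u_\ast(\gamma)$. Then, for every fixed $d\in\mathbb Z_{\ge0}$ and all $A,B\in\mathbb Z$, $$\lim_{N\to\infty}\mathfrak K^{(d)}_{n,\mathrm{Kr}}\bigl(\lfloor uN\rfloor+A,\lfloor uN\rfloor+B\bigr)=\mathbb K_{\sin,\,\phi_\gamma(u)}(A,B),$$ where $$\phi_\gamma(u)=\arccos\left(\frac{1-2\gamma}{\sqrt{1-u^2}}\right).$$
   Context: Let $\mathfrak X=\{-N,\dots,N\}$ and let $w(x)=\binom{2N}{N+x}2^{-2N}$, $x\in\mathfrak X$, be the symmetric Krawtchouk weight. $P_m$ ($0\le m\le 2N$) are the monic orthogonal polynomials on $\mathfrak X$ with respect to $w$, with norms $h_m>0$, $h_m^2=\sum_xP_m(x)^2w(x)$, and $p_m(x)=P_m(x)\sqrt{w(x)}/h_m$. For $d\ge1$, $P_m^{(d)}$ ($0\le m\le2N-1$) are the monic orthogonal polynomials on $\mathfrak X$ with respect to $x^{2d}w(x)$, with norms $h^{(d)}_m>0$ in that weight, and $p^{(d)}_m(x)=P^{(d)}_m(x)\,x^d\sqrt{w(x)}/h^{(d)}_m$. Put $\eta(x)=1$ for $x\ne0$, $\eta(0)=1/\sqrt2$. For $x,y\in\mathfrak X$, $$\mathfrak K^{(0)}_{n,\mathrm{Kr}}(x,y)=2\eta(x)\eta(y)\sum_{\ell=0}^{n-1}p_{2\ell}(x)p_{2\ell}(y),\qquad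 \mathfrak K^{(d)}_{n,\mathrm{Kr}}(x,y)=2\sum_{\ell=0}^{n-1}p^{(d)}_{2\ell}(x)p^{(d)}_{2\ell}(y)\quad(d\ge1).$$ For $\phi\in[0,\pi]$ the discrete sine kernel on $\mathbb Z^2$ is $\mathbb K_{\sin,\phi}(A,B)=\dfrac{\sin(\phi(A-B))}{\pi(A-B)}$ for $A\ne B$ and $\mathbb K_{\sin,\phi}(A,A)=\phi/\pi$. *)

theory Defs
  imports Complex_Main "HOL-Computational_Algebra.Polynomial"
begin

text \<open>
  Monic orthogonal polynomials on a finite set \<open>X\<close> of integer nodes with respect to a
  weight \<open>w\<close>. For \<open>m\<close> at most the number of nodes of positive weight, existence
  and uniqueness are shown in \<open>ex1_monic_orth_poly\<close> below.
\<close>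

definition is_monic_orth_poly :: "int set \<Rightarrow> (int \<Rightarrow> real) \<Rightarrow> nat \<Rightarrow> real poly \<Rightarrow> bool" where
  "is_monic_orth_poly X w m P \<longleftrightarrow>
     degree P = m \<and> lead_coeff P = 1 \<and>
     (\<forall>Q. degree Q < m \<longrightarrow> (\<Sum>x\<in>X. poly P (of_int x) * poly Q (of_int x) * w x) = 0)"

definition monic_orth_poly :: "int set \<Rightarrow> (int \<Rightarrow> real) \<Rightarrow> nat \<Rightarrow> real poly" where
  "monic_orth_poly X w m = (THE P. is_monic_orth_poly X w m P)"

lemma poly_norm_pos:
  fixes P :: "real poly" and w :: "int \<Rightarrow> real"
  assumes "finite X" "\<And>x. x \<in> X \<Longrightarrow> w x \<ge> 0"
    and "P \<noteq> 0" "degree P < card {x\<in>X. w x > 0}"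
  shows "(\<Sum>x\<in>X. poly P (of_int x) * poly P (of_int x) * w x) > 0"
proof -
  have "\<exists>x\<in>{x\<in>X. w x > 0}. poly P (of_int x) \<noteq> 0"
  proof (rule ccontr)
    assume "\<not> ?thesis"
    then have "(of_int :: int \<Rightarrow> real) ` {x\<in>X. w x > 0} \<subseteq> {x. poly P x = 0}" by auto
    then have "card ((of_int :: int \<Rightarrow> real) ` {x\<in>X. w x > 0}) \<le> card {x. poly P x = 0}"
      using poly_roots_finite[OF assms(3)] by (rule card_mono[rotated])
    also have "\<dots> \<le> degree P" using assms(3) by (rule card_poly_roots_bound)
    finally show False using assms(4) by (simp add: card_image inj_on_def)
  qed
  then obtain x where x: "x \<in> X" "w x > 0" "poly P (of_int x) \<noteq> 0" by auto
  have "poly P (of_int x) * poly P (of_int x) > 0" using x(3) by (simp add: zero_less_mult_iff) linarith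
  then have "poly P (of_int x) * poly P (of_int x) * w x > 0" using x(2) by simp
  then show ?thesis
    using assms(1,2) x(1) by (intro sum_pos2[of X x]) auto
qed

lemma ex1_monic_orth_poly:
  fixes w :: "int \<Rightarrow> real"
  assumes fin: "finite X" and nn: "\<And>x. x \<in> X \<Longrightarrow> w x \<ge> 0"
    and "m \<le> card {x\<in>X. w x > 0}"
  shows "\<exists>!P. is_monic_orth_poly X w m P"
proof (rule ex_ex1I)
  define ip where "ip = (\<lambda>P Q :: real poly. \<Sum>x\<in>X. poly P (of_int x) * poly Q (of_int x) * w x)"
  have ip_add: "ip (P + P') Q = ip P Q + ip P' Q"
    and ip_diff: "ip (P - P') Q = ip P Q - ip P' Q"
    and ip_smult: "ip (smult c P) Q = c * ip P Q"
    and ip_comm: "ip P Q = ip Q P" for P P' Q c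
    by (simp_all add: ip_def algebra_simps sum.distrib sum_subtractf sum_distrib_left)
  have ip_sum: "ip (\<Sum>k<j. F k) Q = (\<Sum>k<j. ip (F k) Q)" for F Q and j :: nat
    by (induction j) (simp_all add: ip_add, simp add: ip_def)
  have orth: "is_monic_orth_poly X w k P \<longleftrightarrow>
      degree P = k \<and> lead_coeff P = 1 \<and> (\<forall>Q. degree Q < k \<longrightarrow> ip P Q = 0)" for k P
    by (simp add: is_monic_orth_poly_def ip_def)
  show "\<exists>P. is_monic_orth_poly X w m P"
    using assms(3)
  proof (induction m rule: less_induct)
    case (less m)
    then have "\<forall>k\<in>{..<m}. \<exists>P. is_monic_orth_poly X w k P" by auto
    then obtain F where F: "\<And>k. k < m \<Longrightarrow> is_monic_orth_poly X w k (F k)"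
      by (metis lessThan_iff)
    have Fpos: "ip (F k) (F k) > 0" if "k < m" for k
    proof -
      have "degree (F k) = k" "F k \<noteq> 0" using F[OF that] by (auto simp: orth)
      then show ?thesis
        using poly_norm_pos[where X = X and w = w, OF fin nn, where P = "F k"] less.prems that by (simp add: ip_def)
    qed
    have Forth: "ip (F k) (F j) = 0" if "k < m" "j < m" "k \<noteq> j" for k j
      using F[OF that(1)] F[OF that(2)] that(3) ip_comm[of "F k" "F j"]
      by (cases "k < j") (auto simp: orth)
    define S where "S = (\<Sum>k<m. smult (ip (monom 1 m) (F k) / ip (F k) (F k)) (F k))"
    define P where "P = monom 1 m - S"
    have cS: "coeff S i = 0" if "i \<ge> m" for i
      unfolding S_def coeff_sum using that F
      by (intro sum.neutral) (auto simp: orth intro!: coeff_eq_0)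
    have PF: "ip P (F j) = 0" if "j < m" for j
    proof -
      have "ip S (F j) = (\<Sum>k<m. ip (monom 1 m) (F k) / ip (F k) (F k) * ip (F k) (F j))"
        by (simp add: S_def ip_sum ip_smult)
      also have "\<dots> = (\<Sum>k<m. if k = j then ip (monom 1 m) (F j) else 0)"
        using Forth[OF _ that] Fpos[OF that] by (intro sum.cong) auto
      finally show ?thesis using that by (simp add: P_def ip_diff)
    qed
    have "ip P Q = 0" if "degree Q < m" for Q
      using that
    proof (induction "degree Q" arbitrary: Q rule: less_induct)
      case (less Q)
      define R where "R = Q - smult (lead_coeff Q) (F (degree Q))"
      have FQ: "degree (F (degree Q)) = degree Q" "coeff (F (degree Q)) (degree Q) = 1"
        using F[OF less.prems] by (auto simp: orth)
      have Q: "ip Q P = ip R P"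
        using PF[OF less.prems] ip_comm[of P "F (degree Q)"]
        by (simp add: R_def ip_diff ip_smult)
      have cR: "coeff R i = 0" if "i \<ge> degree Q" for i
        using that FQ by (cases "i = degree Q") (auto simp: R_def coeff_eq_0)
      show ?case
      proof (cases "R = 0")
        case True
        then show ?thesis using Q ip_comm[of P Q] by (simp add: ip_def)
      next
        case False
        then have "degree R < degree Q"
          using cR[of "degree R"] by (meson leading_coeff_0_iff not_le)
        then show ?thesis using less.hyps[of R] less.prems Q ip_comm[of P Q] ip_comm[of P R] by simp
      qed
    qed
    moreover have "coeff P m = 1" by (simp add: P_def cS)
    moreover from this have "degree P = m"
      by (intro antisym degree_le le_degree) (auto simp: P_def cS)
    ultimately show ?case by (auto simp: orth)
  qed
  fix P P' assume PP: "is_monic_orth_poly X w m P" "is_monic_orth_poly X w m P'"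
  show "P = P'"
  proof (rule ccontr)
    assume ne: "P \<noteq> P'"
    have "coeff (P - P') i = 0" if "i \<ge> m" for i
      using PP that by (cases "i = m") (auto simp: orth coeff_eq_0)
    then have d: "degree (P - P') < m"
      using ne by (metis eq_iff_diff_eq_0 leading_coeff_0_iff not_le)
    then have "ip (P - P') (P - P') = 0" using PP by (simp add: orth ip_diff)
    with poly_norm_pos[where X = X and w = w, OF fin nn, where P = "P - P'"] ne d assms(3) show False
      by (simp add: ip_def)
  qed
qed

abbreviation kr_nodes :: "nat \<Rightarrow> int set" where
  "kr_nodes N \<equiv> {- int N..int N}"

text \<open>Only meaningful for \<open>x \<in> kr_nodes N\<close>, as are all functions of a node below.\<close>

definition kr_weight :: "nat \<Rightarrow> int \<Rightarrow> real" where
  "kr_weight N x = real ((2 * N) choose nat (int N + x)) / 2 ^ (2 * N)"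

text \<open>
  The weight \<open>x\<^sup>2\<^sup>d w(x)\<close>. As \<open>0 ^ 0 = 1\<close>, the case \<open>d = 0\<close> is the Krawtchouk
  weight itself, so that the objects below with \<open>d = 0\<close> are the undeformed ones. For
  \<open>d \<ge> 1\<close> the node \<open>0\<close> has weight zero.
\<close>

definition kr_weight_d :: "nat \<Rightarrow> nat \<Rightarrow> int \<Rightarrow> real" where
  "kr_weight_d N d x = (of_int x) ^ (2 * d) * kr_weight N x"

definition kr_poly :: "nat \<Rightarrow> nat \<Rightarrow> nat \<Rightarrow> real poly" where
  "kr_poly N d m = monic_orth_poly (kr_nodes N) (kr_weight_d N d) m"

definition kr_norm :: "nat \<Rightarrow> nat \<Rightarrow> nat \<Rightarrow> real" where
  "kr_norm N d m =
     sqrt (\<Sum>x\<in>kr_nodes N. (poly (kr_poly N d m) (of_int x))\<^sup>2 * kr_weight_d N d x)"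

definition kr_fun :: "nat \<Rightarrow> nat \<Rightarrow> nat \<Rightarrow> int \<Rightarrow> real" where
  "kr_fun N d m x =
     poly (kr_poly N d m) (of_int x) * (of_int x) ^ d * sqrt (kr_weight N x) / kr_norm N d m"

definition kr_eta :: "int \<Rightarrow> real" where
  "kr_eta x = (if x = 0 then 1 / sqrt 2 else 1)"

definition kr_kernel :: "nat \<Rightarrow> nat \<Rightarrow> nat \<Rightarrow> int \<Rightarrow> int \<Rightarrow> real" where
  "kr_kernel N d n x y =
     (if d = 0 then 2 * kr_eta x * kr_eta y * (\<Sum>l<n. kr_fun N 0 (2 * l) x * kr_fun N 0 (2 * l) y)
      else 2 * (\<Sum>l<n. kr_fun N d (2 * l) x * kr_fun N d (2 * l) y))"

definition discrete_sine_kernel :: "real \<Rightarrow> int \<Rightarrow> int \<Rightarrow> real" where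
  "discrete_sine_kernel \<phi> A B =
     (if A = B then \<phi> / pi else sin (\<phi> * of_int (A - B)) / (pi * of_int (A - B)))"

text \<open>
  The range of degrees on which the \<open>kr_poly\<close> are the unique monic orthogonal polynomials,
  with positive norm: \<open>m \<le> 2 * N\<close> for \<open>d = 0\<close> and \<open>m \<le> 2 * N - 1\<close> for \<open>d \<ge> 1\<close>.
\<close>

lemma kr_weight_d_support:
  "{x \<in> kr_nodes N. kr_weight_d N d x > 0} = (if d = 0 then kr_nodes N else kr_nodes N - {0})"
proof -
  have "kr_weight N x > 0" if "x \<in> kr_nodes N" for x
    using that by (auto simp: kr_weight_def)
  then show ?thesis
    by (auto simp: kr_weight_d_def zero_less_mult_iff zero_less_power_eq)
qed

lemma
  assumes "m < (if d = 0 then 2 * N + 1 else 2 * N)"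
  shows kr_poly_is_monic_orth_poly:
      "is_monic_orth_poly (kr_nodes N) (kr_weight_d N d) m (kr_poly N d m)"
    and kr_norm_pos: "kr_norm N d m > 0"
proof -
  have nn: "kr_weight_d N d x \<ge> 0" for x
    by (simp add: kr_weight_d_def kr_weight_def zero_le_power_eq)
  have card: "m < card {x \<in> kr_nodes N. kr_weight_d N d x > 0}"
    using assms unfolding kr_weight_d_support by (simp split: if_splits)
  show *: "is_monic_orth_poly (kr_nodes N) (kr_weight_d N d) m (kr_poly N d m)"
    unfolding kr_poly_def monic_orth_poly_def
    by (rule theI'[OF ex1_monic_orth_poly]) (use nn card in simp_all)
  then have "kr_poly N d m \<noteq> 0" "degree (kr_poly N d m) = m"
    by (auto simp: is_monic_orth_poly_def)
  then show "kr_norm N d m > 0"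
    using poly_norm_pos[where X = "kr_nodes N" and w = "kr_weight_d N d" and P = "kr_poly N d m"] nn card
    by (simp add: kr_norm_def power2_eq_square)
qed

end

theory Submission
  imports Defs "HOL-Analysis.Analysis"
begin

text \<open>
  The orthonormal functions \<open>p\<^sub>m\<close> of the undeformed ensemble are the eigenvectors of a symmetric
  tridiagonal matrix \<open>J\<close> on the nodes (the Krawtchouk difference equation, conjugated by the square
  root of the weight): \<open>J\<close> has zero diagonal, off-diagonal entries
  \<open>sqrt ((N - x) (N + x + 1)) / (2 N)\<close>, and eigenvalues \<open>1 - m / N\<close> in \<open>[-1, 1]\<close>. Hence the full
  Christoffel-Darboux kernel of degree below \<open>M\<close> is the spectral projection of \<open>J\<close> onto eigenvalues
  above \<open>1 - M / N\<close>. Near a node \<open>u N\<close> the entries of \<open>J\<close> tend to \<open>c / 2\<close> with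
  \<open>c = sqrt (1 - u\<^sup>2)\<close>, so that \<open>J\<close> looks like the Laurent matrix with symbol \<open>c cos \<theta>\<close>, whose
  spectral projection onto \<open>c cos \<theta> > 1 - 2 \<gamma>\<close>, that is, onto \<open>\<theta> < \<phi>\<close>, is the discrete sine
  kernel.

  This is made rigorous through moments. A fixed power of \<open>J\<close> involves only finitely many entries
  near a given node, hence its entries converge (\<open>kr_fcalc_power_tendsto\<close>), and entries between
  nodes at distance of order \<open>N\<close> vanish (\<open>kr_fcalc_power_local\<close>). Polynomials \<open>q\<close> and \<open>g\<close> with
  \<open>\<bar>1\<^bsub>s > \<tau>\<^esub> - q s\<bar> \<le> g s\<close> on the spectrum, where \<open>g\<close> has small integral against the limiting
  measure (\<open>step_polynomial_approx\<close>), transfer the convergence to the projection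
  (\<open>kr_cd_tendsto\<close>); this works because the diagonal entries of \<open>g(J)\<close> bound the error of all
  entries. The same approximation shows that a row of the projection carries almost all its mass
  within a bounded distance of the diagonal (\<open>kr_cd_tail\<close>).

  For \<open>d \<ge> 1\<close> the deformed functions of degree below \<open>M\<close> span a subspace \<open>W\<close> of the span \<open>V\<close> of the
  undeformed ones of degree below \<open>M + d\<close>, and the two reproducing kernels satisfy
  \<open>(K\<^sub>W x y - K\<^sub>V x y)\<^sup>2 \<le> K\<^sub>V x x - 2 f x + \<parallel>f\<parallel>\<^sup>2\<close> for every \<open>f\<close> in \<open>W\<close>
  (\<open>kr_cd_comparison\<close>). The function \<open>f y = (y / x)\<^sup>d K y x\<close>, with \<open>K\<close> the undeformed kernel of degree
  below \<open>M\<close>, lies in \<open>W\<close>; since \<open>K\<close> is concentrated near the diagonal and \<open>x\<close> is of order \<open>N\<close>, its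
  squared norm has the same limit \<open>\<phi> / \<pi>\<close> as \<open>K x x\<close>, and the right-hand side tends to \<open>0\<close>. So the
  deformation is invisible in the limit (\<open>kr_cd_deformation_negligible\<close>).

  Finally, as the weights are even, keeping only even degrees and doubling amounts to adding the
  full kernel at \<open>(x, y)\<close> and, up to a sign, at \<open>(x, -y)\<close> (\<open>kr_kernel_eq_cd\<close>). The reflected term
  tends to \<open>0\<close>, because \<open>u \<noteq> 0\<close> puts \<open>x\<close> and \<open>-y\<close> at a distance of order \<open>N\<close>.
\<close>

section \<open>Weighted polynomials and their reproducing kernels\<close>

definition kr_ip :: "nat \<Rightarrow> (int \<Rightarrow> real) \<Rightarrow> (int \<Rightarrow> real) \<Rightarrow> real" where
  "kr_ip N F G = (\<Sum>x\<in>kr_nodes N. F x * G x)"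

text \<open>
  The number of nodes of positive weight, which is the number of degrees with positive norm: for
  \<open>d \<ge> 1\<close> the origin carries no weight.
\<close>

definition kr_dim :: "nat \<Rightarrow> nat \<Rightarrow> nat" where
  "kr_dim N d = (if d = 0 then 2 * N + 1 else 2 * N)"

definition kr_wpoly :: "nat \<Rightarrow> nat \<Rightarrow> real poly \<Rightarrow> int \<Rightarrow> real" where
  "kr_wpoly N d Q x = poly Q (of_int x) * of_int x ^ d * sqrt (kr_weight N x)"

text \<open>
  For \<open>M \<le> kr_dim N d\<close>, the span of \<open>kr_fun N d m\<close> with \<open>m < M\<close>. The vanishing of high coefficients is used in place of
  a degree bound so that \<open>M = 0\<close> gives the zero space.
\<close>

definition kr_space :: "nat \<Rightarrow> nat \<Rightarrow> nat \<Rightarrow> (int \<Rightarrow> real) set" where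
  "kr_space N d M = {kr_wpoly N d Q | Q. \<forall>i\<ge>M. coeff Q i = 0}"

text \<open>
  The Christoffel-Darboux kernel over degrees of both parities. Unlike \<open>kr_kernel\<close>, it is a spectral
  projection and can be compared across \<open>d\<close>.
\<close>

definition kr_cd :: "nat \<Rightarrow> nat \<Rightarrow> nat \<Rightarrow> int \<Rightarrow> int \<Rightarrow> real" where
  "kr_cd N d M x y = (\<Sum>m<M. kr_fun N d m x * kr_fun N d m y)"

lemma kr_weight_nonneg: "kr_weight N x \<ge> 0"
  by (simp add: kr_weight_def)

lemma kr_ip_commute: "kr_ip N F G = kr_ip N G F"
  by (simp add: kr_ip_def mult.commute)

lemma kr_ip_sum_left: "kr_ip N (\<lambda>x. \<Sum>m\<in>S. c m * F m x) G = (\<Sum>m\<in>S. c m * kr_ip N (F m) G)"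
  unfolding kr_ip_def sum_distrib_right sum_distrib_left
  by (subst sum.swap) (simp add: mult_ac)

lemma kr_ip_sum_right: "kr_ip N G (\<lambda>x. \<Sum>m\<in>S. c m * F m x) = (\<Sum>m\<in>S. c m * kr_ip N G (F m))"
  by (subst (1 2) kr_ip_commute) (rule kr_ip_sum_left)

lemma kr_ip_diff_square:
  "kr_ip N (\<lambda>x. F x - G x) (\<lambda>x. F x - G x) = kr_ip N F F - 2 * kr_ip N F G + kr_ip N G G"
  by (simp add: kr_ip_def algebra_simps sum.distrib sum_subtractf sum_distrib_left)

lemma kr_ip_square_nonneg: "kr_ip N F F \<ge> 0"
  by (simp add: kr_ip_def sum_nonneg)

lemma square_le_kr_ip:
  assumes "y \<in> kr_nodes N"
  shows "(F y)\<^sup>2 \<le> kr_ip N F F"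
  unfolding kr_ip_def using assms
  by (subst power2_eq_square, intro member_le_sum[where f = "\<lambda>x. F x * F x"]) auto

lemma kr_ip_wpoly:
  "kr_ip N (kr_wpoly N d P) (kr_wpoly N d Q) =
     (\<Sum>x\<in>kr_nodes N. poly P (of_int x) * poly Q (of_int x) * kr_weight_d N d x)"
  unfolding kr_ip_def
proof (intro sum.cong refl)
  fix x
  have "sqrt (kr_weight N x) * sqrt (kr_weight N x) = kr_weight N x"
    by (simp add: kr_weight_nonneg)
  then show "kr_wpoly N d P x * kr_wpoly N d Q x = poly P (of_int x) * poly Q (of_int x) * kr_weight_d N d x"
    by (simp add: kr_wpoly_def kr_weight_d_def power2_eq_square power_mult power_mult_distrib)
qed

lemma kr_fun_wpoly: "kr_fun N d m = (\<lambda>x. kr_wpoly N d (kr_poly N d m) x / kr_norm N d m)"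
  by (auto simp: kr_fun_def kr_wpoly_def)

lemma
  assumes "m < kr_dim N d"
  shows kr_poly_orth: "is_monic_orth_poly (kr_nodes N) (kr_weight_d N d) m (kr_poly N d m)"
    and kr_norm_positive: "kr_norm N d m > 0"
  using kr_poly_is_monic_orth_poly[of m d N] kr_norm_pos[of m d N] assms by (simp_all add: kr_dim_def)

lemma kr_fun_orthonormal:
  assumes "m < kr_dim N d" "k < kr_dim N d"
  shows "kr_ip N (kr_fun N d m) (kr_fun N d k) = (if m = k then 1 else 0)"
proof -
  have less: "kr_ip N (kr_wpoly N d (kr_poly N d m)) (kr_wpoly N d (kr_poly N d k)) = 0"
    if "m < kr_dim N d" "k < m" for m k
    using kr_poly_orth[OF that(1)] kr_poly_orth[OF less_trans[OF that(2,1)]] that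
    unfolding kr_ip_wpoly by (auto simp: is_monic_orth_poly_def)
  have scale: "kr_ip N (kr_fun N d m) (kr_fun N d k) =
      kr_ip N (kr_wpoly N d (kr_poly N d m)) (kr_wpoly N d (kr_poly N d k)) / (kr_norm N d m * kr_norm N d k)"
    by (simp add: kr_fun_wpoly kr_ip_def sum_divide_distrib)
  show ?thesis
  proof (cases "m = k")
    case True
    have "kr_ip N (kr_wpoly N d (kr_poly N d m)) (kr_wpoly N d (kr_poly N d m)) = (kr_norm N d m)\<^sup>2"
      unfolding kr_ip_wpoly kr_norm_def
      by (subst real_sqrt_pow2)
         (auto simp: power2_eq_square kr_weight_d_def kr_weight_nonneg power_mult intro!: sum_nonneg)
    then show ?thesis using kr_norm_positive[OF assms(1)] True scale by (simp add: power2_eq_square)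
  next
    case False
    then consider "k < m" | "m < k" by linarith
    then have "kr_ip N (kr_wpoly N d (kr_poly N d m)) (kr_wpoly N d (kr_poly N d k)) = 0"
      using less[OF assms(1), of k] less[OF assms(2), of m] by cases (metis kr_ip_commute)+
    then show ?thesis using False scale by simp
  qed
qed

lemma kr_space_expansion:
  assumes "F \<in> kr_space N d M" "M \<le> kr_dim N d"
  shows "\<exists>c. F = (\<lambda>x. \<Sum>m<M. c m * kr_fun N d m x)"
proof -
  have "\<exists>c. kr_wpoly N d Q = (\<lambda>x. \<Sum>m<M. c m * kr_fun N d m x)" if "\<forall>i\<ge>M. coeff Q i = 0" for Q
    using that assms(2)
  proof (induction M arbitrary: Q)
    case 0
    then have "Q = 0" by (simp add: poly_eq_iff)
    then show ?case by (auto simp: kr_wpoly_def)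
  next
    case (Suc M)
    have orth: "degree (kr_poly N d M) = M" "coeff (kr_poly N d M) M = 1"
      using kr_poly_orth[of M N d] Suc.prems by (auto simp: is_monic_orth_poly_def)
    define R where "R = Q - smult (coeff Q M) (kr_poly N d M)"
    have "coeff R i = 0" if "i \<ge> M" for i
      using that Suc.prems(1) orth by (cases "i = M") (auto simp: R_def coeff_eq_0)
    then obtain c where c: "kr_wpoly N d R = (\<lambda>x. \<Sum>m<M. c m * kr_fun N d m x)"
      using Suc.IH[of R] Suc.prems(2) by auto
    have nz: "kr_norm N d M \<noteq> 0" using kr_norm_positive[of M N d] Suc.prems(2) by simp
    have "kr_wpoly N d Q x = (\<Sum>m<Suc M. (c(M := coeff Q M * kr_norm N d M)) m * kr_fun N d m x)" for x
    proof -
      have "kr_wpoly N d Q x = kr_wpoly N d R x + coeff Q M * kr_wpoly N d (kr_poly N d M) x"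
        by (simp add: kr_wpoly_def R_def algebra_simps)
      also have "\<dots> = (\<Sum>m<M. c m * kr_fun N d m x) + coeff Q M * kr_norm N d M * kr_fun N d M x"
        using nz by (simp add: c kr_fun_wpoly)
      finally show ?thesis by simp
    qed
    then show ?case by blast
  qed
  then show ?thesis using assms(1) by (auto simp: kr_space_def)
qed

lemma kr_cd_reproducing:
  assumes "F \<in> kr_space N d M" "M \<le> kr_dim N d"
  shows "kr_ip N (kr_cd N d M x) F = F x"
proof -
  obtain c where c: "F = (\<lambda>x. \<Sum>m<M. c m * kr_fun N d m x)"
    using kr_space_expansion[OF assms] by blast
  have "kr_ip N (kr_cd N d M x) F = (\<Sum>m<M. kr_fun N d m x * kr_ip N (kr_fun N d m) F)"
    unfolding kr_cd_def[abs_def] by (rule kr_ip_sum_left)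
  also have "\<dots> = (\<Sum>m<M. c m * kr_fun N d m x)"
  proof (intro sum.cong refl)
    fix m assume "m \<in> {..<M}"
    have "kr_ip N (kr_fun N d m) F = (\<Sum>k<M. c k * kr_ip N (kr_fun N d m) (kr_fun N d k))"
      unfolding c by (rule kr_ip_sum_right)
    also have "\<dots> = (\<Sum>k<M. if k = m then c m else 0)"
      using assms(2) \<open>m \<in> {..<M}\<close> by (intro sum.cong refl) (auto simp: kr_fun_orthonormal)
    also have "\<dots> = c m" using \<open>m \<in> {..<M}\<close> by simp
    finally show "kr_fun N d m x * kr_ip N (kr_fun N d m) F = c m * kr_fun N d m x" by simp
  qed
  finally show ?thesis by (simp add: c)
qed

lemma kr_cd_in_kr_space:
  assumes "M \<le> kr_dim N d"
  shows "kr_cd N d M x \<in> kr_space N d M"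
proof -
  define Q where "Q = (\<Sum>m<M. smult (kr_fun N d m x / kr_norm N d m) (kr_poly N d m))"
  have "kr_cd N d M x = kr_wpoly N d Q"
    by (rule ext) (simp add: kr_cd_def Q_def kr_wpoly_def kr_fun_def poly_sum sum_distrib_left sum_distrib_right mult_ac)
  moreover have "coeff Q i = 0" if "i \<ge> M" for i
    unfolding Q_def coeff_sum
    using that assms kr_poly_orth[of _ N d]
    by (intro sum.neutral) (auto simp: is_monic_orth_poly_def intro!: coeff_eq_0)
  ultimately show ?thesis unfolding kr_space_def by blast
qed

text \<open>
  The factor \<open>x\<^sup>d\<close> can be absorbed into the polynomial: every deformed space sits inside an
  undeformed one. This is what makes the case \<open>d \<ge> 1\<close> a perturbation of \<open>d = 0\<close>.
\<close>

lemma kr_space_shift: "kr_space N d M \<subseteq> kr_space N 0 (M + d)"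
proof
  fix F assume "F \<in> kr_space N d M"
  then obtain Q where Q: "F = kr_wpoly N d Q" "\<forall>i\<ge>M. coeff Q i = 0" by (auto simp: kr_space_def)
  have "F = kr_wpoly N 0 (monom 1 d * Q)"
    by (auto simp: Q(1) kr_wpoly_def poly_monom)
  moreover have "\<forall>i\<ge>M+d. coeff (monom 1 d * Q) i = 0"
    using Q(2) by (auto simp: coeff_monom_mult)
  ultimately show "F \<in> kr_space N 0 (M + d)" unfolding kr_space_def by blast
qed

lemma kr_space_mult_power:
  assumes "F \<in> kr_space N 0 M"
  shows "(\<lambda>y. a * of_int y ^ d * F y) \<in> kr_space N d M"
proof -
  obtain Q where Q: "F = kr_wpoly N 0 Q" "\<forall>i\<ge>M. coeff Q i = 0" using assms by (auto simp: kr_space_def)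
  have "(\<lambda>y. a * of_int y ^ d * F y) = kr_wpoly N d (smult a Q)"
    by (auto simp: Q(1) kr_wpoly_def)
  moreover have "\<forall>i\<ge>M. coeff (smult a Q) i = 0" using Q(2) by simp
  ultimately show ?thesis unfolding kr_space_def by blast
qed

lemma kr_cd_idem:
  assumes "M \<le> kr_dim N d"
  shows "kr_ip N (kr_cd N d M x) (kr_cd N d M y) = kr_cd N d M x y"
  using kr_cd_reproducing[OF kr_cd_in_kr_space[OF assms] assms] 
  by (simp add: kr_cd_def mult.commute)

text \<open>
  Let \<open>W \<subseteq> V\<close> be the spaces with reproducing kernels \<open>kr_cd N d M\<close> and \<open>kr_cd N 0 (M + d)\<close>. The
  rows at \<open>x\<close> are the projections of the unit mass at \<open>x\<close> onto \<open>W\<close> and \<open>V\<close>, so by Pythagoras their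
  difference has squared norm \<open>K\<^sub>V x x - K\<^sub>W x x\<close>, and any single entry is bounded by the norm.
  A test function \<open>f\<close> in \<open>W\<close> bounds \<open>K\<^sub>W x x\<close> from below, through
  \<open>0 \<le> \<parallel>K\<^sub>W x - f\<parallel>\<^sup>2 = K\<^sub>W x x - 2 f x + \<parallel>f\<parallel>\<^sup>2\<close>.
\<close>

lemma kr_cd_comparison:
  assumes M: "M \<le> kr_dim N d" "M + d \<le> 2 * N + 1" and y: "y \<in> kr_nodes N" and f: "f \<in> kr_space N d M"
  shows "(kr_cd N d M x y - kr_cd N 0 (M + d) x y)\<^sup>2 \<le> kr_cd N 0 (M + d) x x - 2 * f x + kr_ip N f f"
proof -
  let ?G = "kr_cd N d M x" and ?H = "kr_cd N 0 (M + d) x"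
  have M0: "M + d \<le> kr_dim N 0" using M(2) by (simp add: kr_dim_def)
  have GH: "kr_ip N ?G ?H = ?G x"
    using kr_cd_reproducing[OF subsetD[OF kr_space_shift kr_cd_in_kr_space[OF M(1)]] M0]
    by (simp add: kr_ip_commute)
  have "(?G y - ?H y)\<^sup>2 \<le> kr_ip N (\<lambda>z. ?G z - ?H z) (\<lambda>z. ?G z - ?H z)"
    by (rule square_le_kr_ip[OF y])
  also have "\<dots> = ?H x - ?G x"
    unfolding kr_ip_diff_square GH by (simp add: kr_cd_idem M(1) M0)
  also have "\<dots> \<le> ?H x - 2 * f x + kr_ip N f f"
    using kr_ip_square_nonneg[of N "\<lambda>z. ?G z - f z"] 
    unfolding kr_ip_diff_square kr_cd_idem[OF M(1)] kr_cd_reproducing[OF f M(1)] by simp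
  finally show ?thesis .
qed

text \<open>
  There are as many orthonormal functions as nodes. The proof applies the reproducing property to
  the Lagrange polynomial at \<open>y\<close>, which has degree \<open>2 N\<close>.
\<close>

lemma kr_cd_complete:
  assumes "x \<in> kr_nodes N" "y \<in> kr_nodes N"
  shows "kr_cd N 0 (2 * N + 1) x y = (if x = y then 1 else 0)"
proof -
  define L :: "real poly" where "L = (\<Prod>z\<in>kr_nodes N - {y}. [:- of_int z, 1:])"
  define F where "F = kr_wpoly N 0 L"
  have "degree L = (\<Sum>z\<in>kr_nodes N - {y}. 1)"
    unfolding L_def by (subst degree_prod_eq_sum_degree) auto
  also have "\<dots> = 2 * N" using assms(2) by simp
  finally have "F \<in> kr_space N 0 (2 * N + 1)"
    by (auto simp: F_def kr_space_def intro!: exI[of _ L] coeff_eq_0)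
  then have rep: "kr_ip N (kr_cd N 0 (2 * N + 1) x) F = F x"
    by (rule kr_cd_reproducing) (simp add: kr_dim_def)
  have F0: "F z = 0" if "z \<in> kr_nodes N" "z \<noteq> y" for z
    using that by (auto simp: F_def kr_wpoly_def L_def poly_prod)
  have "kr_weight N y > 0" using assms(2) by (auto simp: kr_weight_def)
  then have Fy: "F y \<noteq> 0"
    by (auto simp: F_def kr_wpoly_def L_def poly_prod)
  have "kr_ip N (kr_cd N 0 (2 * N + 1) x) F = (\<Sum>z\<in>kr_nodes N. if z = y then kr_cd N 0 (2 * N + 1) x y * F y else 0)"
    unfolding kr_ip_def by (intro sum.cong refl) (auto simp: F0)
  also have "\<dots> = kr_cd N 0 (2 * N + 1) x y * F y" using assms(2) by simp
  finally show ?thesis using rep Fy F0[OF assms(1)] by auto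
qed

section \<open>The Krawtchouk difference equation\<close>

text \<open>
  For \<open>s = 1\<close> this is the Krawtchouk difference operator. The case \<open>s = -1\<close> is what appears when
  the difference operator is commuted with multiplication by the variable (\<open>kr_op_pCons\<close>).
\<close>

definition kr_op :: "nat \<Rightarrow> real \<Rightarrow> real poly \<Rightarrow> real poly" where
  "kr_op N s Q = [:real N, -1:] * (Q \<circ>\<^sub>p [:1, 1:]) + smult s ([:real N, 1:] * (Q \<circ>\<^sub>p [:-1, 1:]))"

lemma poly_kr_op: "poly (kr_op N s Q) x = (real N - x) * poly Q (x + 1) + s * ((real N + x) * poly Q (x - 1))"
  by (simp add: kr_op_def poly_pcompose algebra_simps)

lemma kr_op_pCons:
  "kr_op N 1 (pCons a Q) = [:2 * real N * a:] + pCons 0 (kr_op N 1 Q) + kr_op N (-1) Q"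
  "kr_op N (-1) (pCons a Q) = [:0, - 2 * a:] + pCons 0 (kr_op N (-1) Q) + kr_op N 1 Q"
  by (rule poly_eq_poly_eq_iff[THEN iffD1], rule ext, simp add: poly_kr_op algebra_simps)+

text \<open>
  The difference operator is triangular on the monomials, with diagonal \<open>2 (N - m)\<close>. The statement
  about \<open>s = -1\<close> is there because the two operators are coupled by \<open>kr_op_pCons\<close>, so that only a
  simultaneous induction closes.
\<close>

lemma coeff_kr_op:
  assumes "\<forall>i>m. coeff Q i = 0"
  shows "(\<forall>i>m. coeff (kr_op N 1 Q) i = 0) \<and> coeff (kr_op N 1 Q) m = 2 * (real N - real m) * coeff Q m \<and>
    (\<forall>i>Suc m. coeff (kr_op N (-1) Q) i = 0) \<and> coeff (kr_op N (-1) Q) (Suc m) = - 2 * coeff Q m"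
  using assms
proof (induction m arbitrary: Q)
  case 0
  obtain a Q' where Q: "Q = pCons a Q'" by (rule pCons_cases)
  then have "coeff Q' i = 0" for i using 0[rule_format, of "Suc i"] by simp
  then have Q': "Q' = 0" by (simp add: poly_eq_iff)
  have z: "kr_op N s 0 = 0" for s by (simp add: kr_op_def)
  show ?case unfolding Q kr_op_pCons Q' z
    by (auto simp: coeff_pCons split: nat.splits)
next
  case (Suc m)
  obtain a Q' where Q: "Q = pCons a Q'" by (rule pCons_cases)
  then have "\<forall>i>m. coeff Q' i = 0" using Suc.prems by (metis Suc_mono coeff_pCons_Suc)
  note IH = Suc.IH[OF this]
  show ?case unfolding Q kr_op_pCons
    using IH by (auto simp: coeff_pCons algebra_simps split: nat.splits)
qed

lemma kr_weight_step:
  assumes "x \<in> kr_nodes N"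
  shows "(real_of_int x + real N + 1) * kr_weight N (x + 1) = (real N - real_of_int x) * kr_weight N x"
proof -
  define k where "k = nat (int N + x)"
  have x: "x = int k - int N" and k: "k \<le> 2 * N" using assms by (auto simp: k_def)
  have "Suc k * ((2 * N) choose Suc k) = (2 * N - k) * ((2 * N) choose k)"
    by (metis binomial_absorb_comp binomial_absorption)
  then have "real (Suc k) * real ((2 * N) choose Suc k) = real (2 * N - k) * real ((2 * N) choose k)"
    by (metis of_nat_mult)
  moreover have "nat (int N + (x + 1)) = Suc k" "nat (int N + x) = k"
    by (auto simp: x)
  ultimately show ?thesis using k by (simp add: kr_weight_def x of_nat_diff algebra_simps)
qed

text \<open>
  Summation by parts: the forward and the backward half of the difference operator are adjoint to
  each other in the weighted inner product. The boundary terms vanish since \<open>N - x\<close> and \<open>N + x\<close>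
  vanish at the end nodes.
\<close>

lemma sum_kr_weight_shift:
  "(\<Sum>x\<in>kr_nodes N. (real N - of_int x) * F (x + 1) * G x * kr_weight N x) =
   (\<Sum>x\<in>kr_nodes N. (real N + of_int x) * F x * G (x - 1) * kr_weight N x)"
proof (rule sum.reindex_bij_witness_not_neutral[where S' = "{int N}" and T' = "{- int N}"
      and h = "\<lambda>x. (real N + of_int x) * F x * G (x - 1) * kr_weight N x"
      and g = "\<lambda>x. (real N - of_int x) * F (x + 1) * G x * kr_weight N x" and i = "\<lambda>x. x - 1" and j = "\<lambda>x. x + 1"])
  fix x assume "x \<in> kr_nodes N"
  then have "(real N + of_int (x + 1)) * kr_weight N (x + 1) = (real N - of_int x) * kr_weight N x"
    using kr_weight_step[of x N] by (simp add: add_ac)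
  then have "F (x + 1) * G x * ((real N + of_int (x + 1)) * kr_weight N (x + 1)) =
      F (x + 1) * G x * ((real N - of_int x) * kr_weight N x)" by simp
  then show "(real N + of_int (x + 1)) * F (x + 1) * G (x + 1 - 1) * kr_weight N (x + 1) =
      (real N - of_int x) * F (x + 1) * G x * kr_weight N x"
    by (simp only: mult_ac add_diff_cancel_right')
qed auto

lemma kr_op_symmetric:
  "(\<Sum>x\<in>kr_nodes N. poly (kr_op N 1 P) (of_int x) * poly Q (of_int x) * kr_weight N x) =
   (\<Sum>x\<in>kr_nodes N. poly P (of_int x) * poly (kr_op N 1 Q) (of_int x) * kr_weight N x)"
proof -
  define p q :: "int \<Rightarrow> real" where "p x = poly P (of_int x)" and "q x = poly Q (of_int x)" for x
  have T: "(\<Sum>x\<in>kr_nodes N. poly (kr_op N 1 P) (of_int x) * q x * kr_weight N x) =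
     (\<Sum>x\<in>kr_nodes N. (real N - of_int x) * p (x + 1) * q x * kr_weight N x) +
     (\<Sum>x\<in>kr_nodes N. (real N + of_int x) * q x * p (x - 1) * kr_weight N x)"
    if "p = (\<lambda>x. poly P (of_int x))" for P p q
    unfolding sum.distrib[symmetric] that
    by (intro sum.cong refl) (simp add: poly_kr_op algebra_simps)
  show ?thesis
    using T[OF refl, of P q] T[OF refl, of Q p] sum_kr_weight_shift[of N p q] sum_kr_weight_shift[of N q p]
    by (simp add: p_def q_def mult_ac)
qed

text \<open>
  A symmetric operator that does not raise degrees maps \<open>P\<^sub>m\<close> to a polynomial of degree at most \<open>m\<close>
  that is orthogonal to all lower degrees. Subtracting the right multiple of \<open>P\<^sub>m\<close> leaves a
  remainder of degree below \<open>m\<close> that is orthogonal to itself.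
\<close>

lemma kr_op_eigen:
  assumes m: "m \<le> 2 * N"
  shows "kr_op N 1 (kr_poly N 0 m) = smult (2 * (real N - real m)) (kr_poly N 0 m)"
proof -
  define P where "P = kr_poly N 0 m"
  define R where "R = kr_op N 1 P - smult (2 * (real N - real m)) P"
  have orth: "degree P = m" "coeff P m = 1"
    "\<And>Q. degree Q < m \<Longrightarrow> (\<Sum>x\<in>kr_nodes N. poly P (of_int x) * poly Q (of_int x) * kr_weight N x) = 0"
    using kr_poly_orth[of m N 0] m
    by (auto simp: is_monic_orth_poly_def kr_dim_def P_def kr_weight_d_def)
  have P0: "\<forall>i>m. coeff P i = 0" using orth(1) by (auto intro: coeff_eq_0)
  have R0: "coeff R i = 0" if "i \<ge> m" for i
    using coeff_kr_op[OF P0, of N] that P0 by (cases "i = m") (auto simp: R_def)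
  have "R = 0"
  proof (rule ccontr)
    assume R: "R \<noteq> 0"
    then have deg: "degree R < m" using R0[of "degree R"] by (meson leading_coeff_0_iff not_le)
    have TR0: "\<forall>i>degree R. coeff (kr_op N 1 R) i = 0"
      by (rule coeff_kr_op[THEN conjunct1]) (auto intro: coeff_eq_0)
    then have "degree (kr_op N 1 R) \<le> degree R" by (intro degree_le) auto
    then have "degree (kr_op N 1 R) < m" using deg by simp
    then have "(\<Sum>x\<in>kr_nodes N. poly (kr_op N 1 P) (of_int x) * poly R (of_int x) * kr_weight N x) = 0"
      unfolding kr_op_symmetric by (rule orth(3))
    then have "(\<Sum>x\<in>kr_nodes N. poly R (of_int x) * poly R (of_int x) * kr_weight N x) = 0"
    proof -
      have "(\<Sum>x\<in>kr_nodes N. poly R (of_int x) * poly R (of_int x) * kr_weight N x) =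
          (\<Sum>x\<in>kr_nodes N. poly (kr_op N 1 P) (of_int x) * poly R (of_int x) * kr_weight N x
             - 2 * (real N - real m) * (poly P (of_int x) * poly R (of_int x) * kr_weight N x))"
        by (subst (1) R_def) (simp add: algebra_simps)
      then show ?thesis
        using orth(3)[OF deg] \<open>(\<Sum>x\<in>kr_nodes N. poly (kr_op N 1 P) (of_int x) * poly R (of_int x) * kr_weight N x) = 0\<close>
        by (simp only: sum_subtractf sum_distrib_left[symmetric] mult_zero_right diff_self)
    qed
    moreover have "(\<Sum>x\<in>kr_nodes N. poly R (of_int x) * poly R (of_int x) * kr_weight N x) > 0"
    proof (rule poly_norm_pos)
      have "{x \<in> kr_nodes N. 0 < kr_weight N x} = kr_nodes N"
        using kr_weight_d_support[of N 0] by (simp add: kr_weight_d_def)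
      then show "degree R < card {x \<in> kr_nodes N. 0 < kr_weight N x}" using deg m by simp
    qed (auto simp: R kr_weight_nonneg)
    ultimately show False by simp
  qed
  then show ?thesis by (simp add: R_def P_def)
qed

section \<open>Functional calculus of the Jacobi matrix\<close>

text \<open>
  The off-diagonal entry of the Jacobi matrix \<open>J\<close> between the nodes \<open>x\<close> and \<open>x + 1\<close>. It vanishes at
  \<open>x = N\<close> and \<open>x = - N - 1\<close>, so that \<open>J\<close> does not see values outside the nodes.
\<close>

definition kr_hop :: "nat \<Rightarrow> int \<Rightarrow> real" where
  "kr_hop N x = sqrt ((real N - of_int x) * (real N + of_int x + 1)) / (2 * real N)"

definition kr_eig :: "nat \<Rightarrow> nat \<Rightarrow> real" where
  "kr_eig N m = 1 - real m / real N"

text \<open>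
  The difference equation of \<open>kr_op_eigen\<close>, conjugated by the square root of the weight and divided
  by \<open>2 N\<close>: \<open>kr_fun N 0 m\<close> is an eigenvector of \<open>J\<close>. Nothing is lost at the end nodes, where the
  coefficient of the missing neighbour is zero.
\<close>

lemma kr_fun_recurrence:
  assumes N: "N > 0" and m: "m \<le> 2 * N" and x: "x \<in> kr_nodes N"
  shows "kr_eig N m * kr_fun N 0 m x =
    kr_hop N x * kr_fun N 0 m (x + 1) + kr_hop N (x - 1) * kr_fun N 0 m (x - 1)"
proof -
  define P where "P y = poly (kr_poly N 0 m) y" for y
  have "poly (kr_op N 1 (kr_poly N 0 m)) (of_int x) = 2 * (real N - real m) * P (of_int x)"
    by (simp add: kr_op_eigen[OF m] P_def)
  then have eig: "(real N - of_int x) * P (of_int x + 1) + (real N + of_int x) * P (of_int x - 1) =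
      2 * (real N - real m) * P (of_int x)"
    by (simp add: poly_kr_op P_def)
  have up: "sqrt ((real N - of_int x) * (real N + of_int x + 1)) * sqrt (kr_weight N (x + 1)) =
      (real N - of_int x) * sqrt (kr_weight N x)"
  proof -
    have "(real N - of_int x) * (real N + of_int x + 1) * kr_weight N (x + 1) = (real N - of_int x)\<^sup>2 * kr_weight N x"
      using arg_cong[OF kr_weight_step[OF x], of "\<lambda>t. (real N - of_int x) * t"]
      by (simp add: power2_eq_square algebra_simps)
    then show ?thesis using x
      by (simp add: real_sqrt_mult[symmetric]) (simp add: real_sqrt_mult)
  qed
  have down: "sqrt ((real N - of_int (x - 1)) * (real N + of_int (x - 1) + 1)) * sqrt (kr_weight N (x - 1)) =
      (real N + of_int x) * sqrt (kr_weight N x)"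
  proof (cases "x = - int N")
    case False
    then have "(real N - of_int (x - 1)) * (real N + of_int (x - 1) + 1) * kr_weight N (x - 1) = (real N + of_int x)\<^sup>2 * kr_weight N x"
      using arg_cong[OF kr_weight_step[of "x - 1" N], of "\<lambda>t. (real N + of_int x) * t"] x
      by (simp add: power2_eq_square algebra_simps)
    then show ?thesis using x
      by (simp add: real_sqrt_mult[symmetric]) (simp add: real_sqrt_mult)
  qed simp
  have "kr_hop N x * kr_fun N 0 m (x + 1) + kr_hop N (x - 1) * kr_fun N 0 m (x - 1) =
     (P (of_int x + 1) * (sqrt ((real N - of_int x) * (real N + of_int x + 1)) * sqrt (kr_weight N (x + 1))) +
      P (of_int x - 1) * (sqrt ((real N - of_int (x - 1)) * (real N + of_int (x - 1) + 1)) * sqrt (kr_weight N (x - 1))))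
       / (2 * real N * kr_norm N 0 m)"
    by (simp add: kr_hop_def kr_fun_def P_def add_divide_distrib mult_ac)
  also have "\<dots> = ((real N - of_int x) * P (of_int x + 1) + (real N + of_int x) * P (of_int x - 1)) *
       sqrt (kr_weight N x) / (2 * real N * kr_norm N 0 m)"
    unfolding up down by (simp add: algebra_simps)
  also have "\<dots> = kr_eig N m * kr_fun N 0 m x"
  proof -
    have "kr_eig N m = (real N - real m) / real N" using N by (simp add: kr_eig_def diff_divide_distrib)
    moreover have "2 * r * p * w / (2 * n * h) = r / n * (p * w / h)" for r p w n h :: real by simp
    ultimately show ?thesis unfolding eig by (simp only: kr_fun_def P_def power_0 mult_1_right)
  qed
  finally show ?thesis by simp
qed

text \<open>
  For nodes \<open>x\<close> and \<open>y\<close>, the matrix entries of \<open>f(J)\<close>, written through the spectral decomposition of \<open>J\<close>.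
\<close>

definition kr_fcalc :: "nat \<Rightarrow> (real \<Rightarrow> real) \<Rightarrow> int \<Rightarrow> int \<Rightarrow> real" where
  "kr_fcalc N f x y = (\<Sum>m<2 * N + 1. f (kr_eig N m) * (kr_fun N 0 m x * kr_fun N 0 m y))"

lemma kr_fcalc_one:
  assumes "x \<in> kr_nodes N" "y \<in> kr_nodes N"
  shows "kr_fcalc N (\<lambda>s. 1) x y = (if x = y then 1 else 0)"
  using kr_cd_complete[OF assms] by (simp add: kr_fcalc_def kr_cd_def)

lemma kr_fcalc_power_Suc:
  assumes "N > 0" "x \<in> kr_nodes N"
  shows "kr_fcalc N (\<lambda>s. s ^ Suc k) x y =
    kr_hop N x * kr_fcalc N (\<lambda>s. s ^ k) (x + 1) y + kr_hop N (x - 1) * kr_fcalc N (\<lambda>s. s ^ k) (x - 1) y"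
proof -
  have "kr_eig N m ^ Suc k * (kr_fun N 0 m x * kr_fun N 0 m y) =
      kr_hop N x * (kr_eig N m ^ k * (kr_fun N 0 m (x + 1) * kr_fun N 0 m y)) +
      kr_hop N (x - 1) * (kr_eig N m ^ k * (kr_fun N 0 m (x - 1) * kr_fun N 0 m y))" if "m < 2 * N + 1" for m
  proof -
    have "kr_eig N m ^ Suc k * (kr_fun N 0 m x * kr_fun N 0 m y) =
        kr_eig N m ^ k * kr_fun N 0 m y * (kr_eig N m * kr_fun N 0 m x)" by simp
    also have "\<dots> = kr_eig N m ^ k * kr_fun N 0 m y *
        (kr_hop N x * kr_fun N 0 m (x + 1) + kr_hop N (x - 1) * kr_fun N 0 m (x - 1))"
      using kr_fun_recurrence[OF assms(1) _ assms(2), of m] that by simp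
    finally show ?thesis by (simp add: algebra_simps)
  qed
  then show ?thesis
    unfolding kr_fcalc_def sum_distrib_left sum.distrib[symmetric] by (intro sum.cong refl) auto
qed

text \<open>
  \<open>J\<close> is tridiagonal, so its \<open>k\<close>-th power has bandwidth \<open>k\<close>.
\<close>

lemma kr_fcalc_power_local:
  assumes "N > 0" "x \<in> kr_nodes N" "y \<in> kr_nodes N" "\<bar>x - y\<bar> > int k"
  shows "kr_fcalc N (\<lambda>s. s ^ k) x y = 0"
  using assms(2,4)
proof (induction k arbitrary: x)
  case 0
  then show ?case using kr_fcalc_one[OF _ assms(3), of x] by simp
next
  case (Suc k)
  have "kr_hop N x * kr_fcalc N (\<lambda>s. s ^ k) (x + 1) y = 0"
    using Suc.IH[of "x + 1"] Suc.prems by (cases "x = int N") (auto simp: kr_hop_def)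
  moreover have "kr_hop N (x - 1) * kr_fcalc N (\<lambda>s. s ^ k) (x - 1) y = 0"
    using Suc.IH[of "x - 1"] Suc.prems by (cases "x = - int N") (auto simp: kr_hop_def)
  ultimately show ?case unfolding kr_fcalc_power_Suc[OF assms(1) Suc.prems(1)] by linarith
qed

lemma kr_fcalc_poly:
  "kr_fcalc N (poly q) x y = (\<Sum>i\<le>degree q. coeff q i * kr_fcalc N (\<lambda>s. s ^ i) x y)"
  unfolding kr_fcalc_def poly_altdef sum_distrib_left sum_distrib_right
  by (subst sum.swap) (simp add: mult_ac)

lemma kr_fcalc_poly_local:
  assumes "N > 0" "x \<in> kr_nodes N" "y \<in> kr_nodes N" "\<bar>x - y\<bar> > int (degree q)"
  shows "kr_fcalc N (poly q) x y = 0"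
  unfolding kr_fcalc_poly using assms by (intro sum.neutral) (auto intro: kr_fcalc_power_local)

text \<open>
  \<open>f(J)\<close> is symmetric with square \<open>f\<^sup>2(J)\<close>, so the squared norm of a row is a diagonal entry of the
  latter.
\<close>

lemma kr_fcalc_row_norm:
  "kr_ip N (kr_fcalc N f x) (kr_fcalc N f x) = kr_fcalc N (\<lambda>s. (f s)\<^sup>2) x x"
proof -
  have F: "kr_fcalc N f x = (\<lambda>y. \<Sum>m<2*N+1. (f (kr_eig N m) * kr_fun N 0 m x) * kr_fun N 0 m y)"
    by (auto simp: kr_fcalc_def mult_ac)
  have "kr_ip N (kr_fcalc N f x) (kr_fcalc N f x) =
     (\<Sum>m<2*N+1. f (kr_eig N m) * kr_fun N 0 m x * (\<Sum>k<2*N+1. f (kr_eig N k) * kr_fun N 0 k x * kr_ip N (kr_fun N 0 m) (kr_fun N 0 k)))"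
    unfolding F kr_ip_sum_left kr_ip_sum_right ..
  also have "\<dots> = (\<Sum>m<2*N+1. f (kr_eig N m) * kr_fun N 0 m x * (f (kr_eig N m) * kr_fun N 0 m x))"
  proof (intro sum.cong refl)
    fix m assume m: "m \<in> {..<2*N+1}"
    have "(\<Sum>k<2*N+1. f (kr_eig N k) * kr_fun N 0 k x * kr_ip N (kr_fun N 0 m) (kr_fun N 0 k)) =
        (\<Sum>k<2*N+1. if k = m then f (kr_eig N m) * kr_fun N 0 m x else 0)"
      using m by (intro sum.cong refl) (auto simp: kr_fun_orthonormal kr_dim_def)
    then show "f (kr_eig N m) * kr_fun N 0 m x * (\<Sum>k<2*N+1. f (kr_eig N k) * kr_fun N 0 k x * kr_ip N (kr_fun N 0 m) (kr_fun N 0 k)) =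
        f (kr_eig N m) * kr_fun N 0 m x * (f (kr_eig N m) * kr_fun N 0 m x)"
      using m by simp
  qed
  finally show ?thesis by (simp add: kr_fcalc_def power2_eq_square mult_ac)
qed

text \<open>
  The eigenvalue \<open>1 - m / N\<close> decreases in \<open>m\<close>, so low degrees are high eigenvalues.
\<close>

lemma kr_cd_eq_fcalc:
  assumes "N > 0" "M \<le> 2 * N + 1"
  shows "kr_cd N 0 M = kr_fcalc N (\<lambda>s. of_bool (s > 1 - real M / real N))"
proof (intro ext)
  fix x y
  have "kr_fcalc N (\<lambda>s. of_bool (s > 1 - real M / real N)) x y =
     (\<Sum>m<2*N+1. if m < M then kr_fun N 0 m x * kr_fun N 0 m y else 0)"
    unfolding kr_fcalc_def kr_eig_def using assms(1) by (intro sum.cong refl) (auto simp: divide_simps)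
  also have "\<dots> = (\<Sum>m\<in>{m\<in>{..<2*N+1}. m < M}. kr_fun N 0 m x * kr_fun N 0 m y)"
    by (rule sum.inter_filter[symmetric]) simp
  also have "{m\<in>{..<2*N+1}. m < M} = {..<M}" using assms(2) by auto
  finally show "kr_cd N 0 M x y = kr_fcalc N (\<lambda>s. of_bool (s > 1 - real M / real N)) x y"
    by (simp add: kr_cd_def)
qed

lemma kr_eig_bounds: "m < 2 * N + 1 \<Longrightarrow> kr_eig N m \<in> {-1..1}"
  by (cases "N = 0") (auto simp: kr_eig_def divide_simps)

lemma kr_fcalc_diag_mono:
  assumes "\<And>s. s \<in> {-1..1} \<Longrightarrow> f s \<le> g s"
  shows "kr_fcalc N f x x \<le> kr_fcalc N g x x"
  unfolding kr_fcalc_def using assms kr_eig_bounds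
  by (intro sum_mono mult_right_mono) auto

text \<open>
  Pointwise bounds on the spectrum control off-diagonal entries through diagonal ones, because
  \<open>2 \<bar>a b\<bar> \<le> a\<^sup>2 + b\<^sup>2\<close> for the components \<open>a\<close>, \<open>b\<close> of each eigenvector.
\<close>

lemma kr_fcalc_diff_le:
  assumes "\<And>s. s \<in> {-1..1} \<Longrightarrow> \<bar>f s - h s\<bar> \<le> g s"
  shows "\<bar>kr_fcalc N f x y - kr_fcalc N h x y\<bar> \<le> (kr_fcalc N g x x + kr_fcalc N g y y) / 2"
proof -
  have "\<bar>kr_fcalc N f x y - kr_fcalc N h x y\<bar> =
      \<bar>\<Sum>m<2*N+1. (f (kr_eig N m) - h (kr_eig N m)) * (kr_fun N 0 m x * kr_fun N 0 m y)\<bar>"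
    by (simp add: kr_fcalc_def sum_subtractf left_diff_distrib)
  also have "\<dots> \<le> (\<Sum>m<2*N+1. g (kr_eig N m) * ((kr_fun N 0 m x * kr_fun N 0 m x + kr_fun N 0 m y * kr_fun N 0 m y) / 2))"
  proof (rule sum_abs[THEN order_trans], intro sum_mono)
    fix m assume "m \<in> {..<2*N+1}"
    then have le: "\<bar>f (kr_eig N m) - h (kr_eig N m)\<bar> \<le> g (kr_eig N m)"
      using assms kr_eig_bounds by auto
    have "\<bar>a * b\<bar> \<le> (a * a + b * b) / 2" for a b :: real
      using sum_squares_bound[of "\<bar>a\<bar>" "\<bar>b\<bar>"] by (simp add: power2_eq_square abs_mult)
    then show "\<bar>(f (kr_eig N m) - h (kr_eig N m)) * (kr_fun N 0 m x * kr_fun N 0 m y)\<bar>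
        \<le> g (kr_eig N m) * ((kr_fun N 0 m x * kr_fun N 0 m x + kr_fun N 0 m y * kr_fun N 0 m y) / 2)"
      unfolding abs_mult[of "f (kr_eig N m) - h (kr_eig N m)"] using le by (intro mult_mono) auto
  qed
  also have "\<dots> = (kr_fcalc N g x x + kr_fcalc N g y y) / 2"
    by (simp add: kr_fcalc_def sum.distrib algebra_simps add_divide_distrib sum_divide_distrib)
  finally show ?thesis .
qed

section \<open>Polynomial approximation of a step function\<close>

lemma polynomial_approx_on_unit_interval:
  fixes f :: "real \<Rightarrow> real"
  assumes "continuous_on {-1..1} f" "e > 0"
  obtains p :: "real poly" where "\<And>s. s \<in> {-1..1} \<Longrightarrow> \<bar>f s - poly p s\<bar> < e"
proof -
  obtain g where g: "real_polynomial_function g" "\<And>s. s \<in> {-1..1} \<Longrightarrow> \<bar>f s - g s\<bar> < e"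
    using Stone_Weierstrass_real_polynomial_function[OF _ assms] by auto
  obtain a n where an: "g = (\<lambda>x. \<Sum>i\<le>n. a i * x ^ i)"
    using g(1) real_polynomial_function_iff_sum by blast
  have "poly (\<Sum>i\<le>n. monom (a i) i) s = g s" for s
    by (simp add: an poly_sum poly_monom)
  then show thesis using that[of "\<Sum>i\<le>n. monom (a i) i"] g(2) by simp
qed

text \<open>
  The limit functional. With \<open>\<kappa> \<theta> = cos (j \<theta>)\<close> it is the entry, at distance \<open>j\<close> from the diagonal,
  of \<open>f\<close> applied to the Laurent matrix with symbol \<open>c cos \<theta>\<close>. With \<open>\<kappa> = 0\<close> it describes pairs of
  nodes that move apart.
\<close>

definition kr_symbol :: "real \<Rightarrow> (real \<Rightarrow> real) \<Rightarrow> (real \<Rightarrow> real) \<Rightarrow> real" where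
  "kr_symbol c f \<kappa> = integral {0..pi} (\<lambda>\<theta>. f (c * cos \<theta>) * \<kappa> \<theta>) / pi"

text \<open>
  The step function at \<open>c cos \<phi>\<close> is approximated by a polynomial \<open>q\<close>, uniformly except in a window
  that \<open>g\<close> majorises; the limiting measure of the window is small because the image of the uniform
  measure under \<open>\<theta> \<mapsto> c cos \<theta>\<close> has no atom at \<open>c cos \<phi>\<close>. The bound holds for all thresholds \<open>\<tau>\<close>
  close to \<open>c cos \<phi>\<close> at once, as the thresholds \<open>1 - M / N\<close> that occur depend on \<open>N\<close>.
\<close>

lemma step_polynomial_approx:
  fixes c \<phi> \<epsilon> :: real
  assumes c: "0 < c" "c \<le> 1" and \<phi>: "0 < \<phi>" "\<phi> < pi" and \<epsilon>: "\<epsilon> > 0"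
  obtains q g :: "real poly" and \<delta> :: real where "\<delta> > 0"
    "\<And>s \<tau>. s \<in> {-1..1} \<Longrightarrow> \<bar>\<tau> - c * cos \<phi>\<bar> < \<delta> \<Longrightarrow>
       \<bar>of_bool (s > \<tau>) - poly q s\<bar> \<le> poly g s \<and> \<bar>of_bool (s > \<tau>) - poly q s\<bar> \<le> 2"
    "kr_symbol c (poly g) (\<lambda>\<theta>. 1) \<le> \<epsilon>"
proof -
  define t where "t = c * cos \<phi>"
  \<comment> \<open>The window in \<open>\<theta>\<close> contributes at most \<open>2 \<rho>\<close> and the uniform errors \<open>3 \<eta> \<pi>\<close>, each at most \<open>\<pi> \<epsilon> / 2\<close>.\<close>
  define \<rho> where "\<rho> = Min {pi * \<epsilon> / 4, \<phi> / 2, (pi - \<phi>) / 2}"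
  define \<eta> where "\<eta> = min 1 (\<epsilon> / 6)"
  have \<rho>: "\<rho> > 0" "\<rho> \<le> pi * \<epsilon> / 4" "\<rho> < \<phi>" "\<phi> + \<rho> < pi"
    using \<phi> \<epsilon> by (auto simp: \<rho>_def min_def field_simps)
  have \<eta>: "\<eta> > 0" "\<eta> \<le> 1" "3 * \<eta> * pi \<le> pi * \<epsilon> / 2"
    using \<epsilon> pi_gt_zero by (auto simp: \<eta>_def min_def field_simps)
  have cos1: "cos (\<phi> + \<rho>) < cos \<phi>" "cos \<phi> < cos (\<phi> - \<rho>)"
    using \<rho> \<phi> by (auto intro!: cos_monotone_0_pi)
  \<comment> \<open>Chosen such that \<open>\<bar>c cos \<theta> - c cos \<phi>\<bar> < 2 \<delta>\<close> forces \<open>\<bar>\<theta> - \<phi>\<bar> < \<rho>\<close>, for \<open>\<theta>\<close> in \<open>[0, \<pi>]\<close>.\<close>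
  define \<delta> where "\<delta> = c * min (cos \<phi> - cos (\<phi> + \<rho>)) (cos (\<phi> - \<rho>) - cos \<phi>) / 2"
  have \<delta>: "\<delta> > 0" using c cos1 by (simp add: \<delta>_def)
  have \<delta>le: "2 * \<delta> \<le> c * (cos \<phi> - cos (\<phi> + \<rho>))" "2 * \<delta> \<le> c * (cos (\<phi> - \<rho>) - cos \<phi>)"
    using c by (auto simp: \<delta>_def)
  \<comment> \<open>A continuous ramp from 0 to 1 across the window of half-width \<open>\<delta>\<close>,
      and a bump equal to 1 on the window and vanishing at twice that distance.\<close>
  define h where "h s = max 0 (min 1 (((s - t) / \<delta> + 1) / 2))" for s
  define b where "b s = max 0 (min 1 (2 - \<bar>(s - t) / \<delta>\<bar>))" for s
  have "continuous_on {-1..1} h" "continuous_on {-1..1} b"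
    unfolding h_def b_def using \<delta> by (auto intro!: continuous_intros)
  then obtain q g0 :: "real poly" where q: "\<And>s. s \<in> {-1..1} \<Longrightarrow> \<bar>h s - poly q s\<bar> < \<eta>"
    and g0: "\<And>s. s \<in> {-1..1} \<Longrightarrow> \<bar>b s - poly g0 s\<bar> < \<eta>"
    using polynomial_approx_on_unit_interval[OF _ \<eta>(1)] by metis
  define g where "g = g0 + [:2 * \<eta>:]"
  have g: "b s + \<eta> \<le> poly g s" "poly g s \<le> b s + 3 * \<eta>" if "s \<in> {-1..1}" for s
    using g0[OF that] by (auto simp: g_def)
  have h01: "0 \<le> h s" "h s \<le> 1" for s by (auto simp: h_def)
  have A: "\<bar>1 - poly q s\<bar> \<le> poly g s \<and> \<bar>1 - poly q s\<bar> \<le> 2" if "s \<in> {-1..1}" "s > t - \<delta>" for s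
  proof -
    have "(s - t) / \<delta> > -1" using that \<delta> by (simp add: field_simps)
    moreover have "1 - max 0 (min 1 ((r + 1) / 2)) \<le> max 0 (min 1 (2 - \<bar>r\<bar>))" if "r > -1" for r :: real
      using that by (auto simp: max_def min_def abs_if)
    ultimately have "1 - h s \<le> b s" by (simp only: h_def b_def)
    then show ?thesis using q[OF that(1)] g[OF that(1)] h01[of s] \<eta> by linarith
  qed
  have B: "\<bar>poly q s\<bar> \<le> poly g s \<and> \<bar>poly q s\<bar> \<le> 2" if "s \<in> {-1..1}" "s < t + \<delta>" for s
  proof -
    have "(s - t) / \<delta> < 1" using that \<delta> by (simp add: field_simps)
    moreover have "max 0 (min 1 ((r + 1) / 2)) \<le> max 0 (min 1 (2 - \<bar>r\<bar>))" if "r < 1" for r :: real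
      using that by (auto simp: max_def min_def abs_if)
    ultimately have "h s \<le> b s" by (simp only: h_def b_def)
    then show ?thesis using q[OF that(1)] g[OF that(1)] h01[of s] \<eta> by linarith
  qed
  have bcos: "b (c * cos \<theta>) \<le> (if \<theta> \<in> {\<phi> - \<rho>..\<phi> + \<rho>} then 1 else 0)" if "\<theta> \<in> {0..pi}" for \<theta>
  proof (cases "\<theta> \<in> {\<phi> - \<rho>..\<phi> + \<rho>}")
    case True
    then show ?thesis by (simp add: b_def)
  next
    case False
    then consider "\<theta> < \<phi> - \<rho>" | "\<phi> + \<rho> < \<theta>" by fastforce
    then have "2 * \<delta> \<le> \<bar>c * cos \<theta> - t\<bar>"
    proof cases
      case 1
      then have "cos (\<phi> - \<rho>) \<le> cos \<theta>" using that \<rho> \<phi> by (intro cos_monotone_0_pi_le) auto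
      then have "c * (cos (\<phi> - \<rho>) - cos \<phi>) \<le> c * (cos \<theta> - cos \<phi>)" using c by simp
      then show ?thesis using \<delta>le(2) by (simp add: t_def algebra_simps)
    next
      case 2
      then have "cos \<theta> \<le> cos (\<phi> + \<rho>)" using that \<rho> \<phi> by (intro cos_monotone_0_pi_le) auto
      then have "c * (cos \<phi> - cos (\<phi> + \<rho>)) \<le> c * (cos \<phi> - cos \<theta>)" using c by simp
      then show ?thesis using \<delta>le(1) by (simp add: t_def algebra_simps)
    qed
    then have "2 \<le> \<bar>(c * cos \<theta> - t) / \<delta>\<bar>" using \<delta> by (simp add: field_simps)
    then show ?thesis using False by (simp add: b_def)
  qed
  have cin: "c * cos \<theta> \<in> {-1..1}" for \<theta>
  proof -
    have "\<bar>c * cos \<theta>\<bar> \<le> 1 * 1" unfolding abs_mult using c by (intro mult_mono) auto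
    then show ?thesis by auto
  qed
  have "((\<lambda>\<theta>. if \<theta> \<in> {\<phi> - \<rho>..\<phi> + \<rho>} then 1 else 0) has_integral (2 * \<rho>)) {0..pi}"
    using \<rho> has_integral_const_real[of "1::real" "\<phi> - \<rho>" "\<phi> + \<rho>"]
    by (subst has_integral_restrict) auto
  from has_integral_add[OF this has_integral_const_real[of "3 * \<eta>" 0 pi]]
  have ind: "((\<lambda>\<theta>. (if \<theta> \<in> {\<phi> - \<rho>..\<phi> + \<rho>} then 1 else 0) + 3 * \<eta>) has_integral (2 * \<rho> + 3 * \<eta> * pi)) {0..pi}"
    by (simp add: mult_ac)
  have "(\<lambda>\<theta>. poly g (c * cos \<theta>)) integrable_on {0..pi}"
    by (intro integrable_continuous_real continuous_intros)
  then have "integral {0..pi} (\<lambda>\<theta>. poly g (c * cos \<theta>)) \<le> 2 * \<rho> + 3 * \<eta> * pi"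
  proof (rule has_integral_le[OF integrable_integral ind])
    fix \<theta> assume "\<theta> \<in> {0..pi}"
    from bcos[OF this] g(2)[OF cin[of \<theta>]]
    show "poly g (c * cos \<theta>) \<le> (if \<theta> \<in> {\<phi> - \<rho>..\<phi> + \<rho>} then 1 else 0) + 3 * \<eta>" by linarith
  qed
  also have "\<dots> \<le> pi * \<epsilon>" using \<rho>(2) \<eta>(3) by linarith
  finally have "integral {0..pi} (\<lambda>\<theta>. poly g (c * cos \<theta>)) / pi \<le> \<epsilon>"
    by (simp add: divide_le_eq mult.commute)
  moreover have "\<bar>of_bool (s > \<tau>) - poly q s\<bar> \<le> poly g s \<and> \<bar>of_bool (s > \<tau>) - poly q s\<bar> \<le> 2"
    if "s \<in> {-1..1}" "\<bar>\<tau> - t\<bar> < \<delta>" for s \<tau>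
    using A[OF that(1)] B[OF that(1)] that(2) by (cases "s > \<tau>") auto
  ultimately show thesis using that[of \<delta> q g] \<delta> by (simp add: t_def kr_symbol_def)
qed

section \<open>Convergence of moments in the bulk\<close>

lemma kr_hop_tendsto:
  assumes "(\<lambda>N. of_int (X N) / real N) \<longlonglongrightarrow> u"
  shows "(\<lambda>N. kr_hop N (X N)) \<longlonglongrightarrow> sqrt (1 - u\<^sup>2) / 2"
proof -
  have lim: "(\<lambda>N. sqrt ((1 - of_int (X N) / real N) * (1 + of_int (X N) / real N + 1 / real N)) / 2)
      \<longlonglongrightarrow> sqrt ((1 - u) * (1 + u + 0)) / 2"
    by (intro tendsto_intros assms lim_1_over_n) auto
  have ev: "sqrt ((1 - of_int (X N) / real N) * (1 + of_int (X N) / real N + 1 / real N)) / 2 = kr_hop N (X N)"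
    if "N > 0" for N
  proof -
    have "(1 - of_int (X N) / real N) * (1 + of_int (X N) / real N + 1 / real N) =
        ((real N - of_int (X N)) * (real N + of_int (X N) + 1)) / (real N)\<^sup>2"
      using that by (simp add: power2_eq_square field_simps)
    then show ?thesis using that by (simp add: kr_hop_def real_sqrt_divide)
  qed
  have "(1 - u) * (1 + u + 0) = 1 - u\<^sup>2" by (simp add: power2_eq_square algebra_simps)
  note lim = lim[unfolded this]
  have "\<forall>\<^sub>F N in sequentially. sqrt ((1 - of_int (X N) / real N) * (1 + of_int (X N) / real N + 1 / real N)) / 2 = kr_hop N (X N)"
    by (rule eventually_mono[OF eventually_gt_at_top[of 0] ev])
  with lim show ?thesis by (rule Lim_transform_eventually)
qed

lemma of_int_shift_tendsto:
  assumes "(\<lambda>N. of_int (X N) / real N) \<longlonglongrightarrow> u"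
  shows "(\<lambda>N. of_int (X N + j) / real N) \<longlonglongrightarrow> u"
  using tendsto_add[OF assms tendsto_mult_right[OF lim_1_over_n, of "of_int j"]]
  by (simp add: add_divide_distrib)

lemma eventually_in_kr_nodes:
  assumes "(\<lambda>N. of_int (X N) / real N) \<longlonglongrightarrow> u" "\<bar>u\<bar> < 1"
  shows "\<forall>\<^sub>F N in sequentially. X N \<in> kr_nodes N"
proof -
  have "\<forall>\<^sub>F N in sequentially. \<bar>of_int (X N) / real N\<bar> < 1"
    using tendsto_rabs[OF assms(1)] assms(2) by (rule order_tendstoD)
  then show ?thesis using eventually_gt_at_top[of 0]
  proof eventually_elim
    case (elim N)
    then have "\<bar>real_of_int (X N)\<bar> < real N" by (simp add: abs_divide field_simps)
    then show ?case by auto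
  qed
qed

lemma has_integral_cos_mult:
  fixes j :: int and a :: real
  assumes "0 \<le> a"
  shows "((\<lambda>\<theta>. cos (of_int j * \<theta>)) has_integral (if j = 0 then a else sin (of_int j * a) / of_int j)) {0..a}"
proof (cases "j = 0")
  case True
  then show ?thesis using has_integral_const_real[of "1::real" 0 a] assms by simp
next
  case False
  have "((\<lambda>\<theta>. cos (of_int j * \<theta>)) has_integral (sin (of_int j * a) / of_int j - sin (of_int j * 0) / of_int j)) {0..a}"
    using False assms
    by (intro fundamental_theorem_of_calculus)
       (auto intro!: derivative_eq_intros simp: has_real_derivative_iff_has_vector_derivative[symmetric])
  then show ?thesis using False by simp
qed

text \<open>
  Both sides satisfy the same recursion in \<open>k\<close> in the limit: one step of \<open>J\<close> moves to the two
  neighbours with weight tending to \<open>c / 2\<close>, and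
  \<open>2 cos \<theta> cos (j \<theta>) = cos ((j + 1) \<theta>) + cos ((j - 1) \<theta>)\<close>.
\<close>

lemma kr_fcalc_power_tendsto:
  fixes j :: int
  assumes X: "(\<lambda>N. of_int (X N) / real N) \<longlonglongrightarrow> u" and u: "\<bar>u\<bar> < 1"
  shows "(\<lambda>N. kr_fcalc N (\<lambda>s. s ^ k) (X N + j) (X N)) \<longlonglongrightarrow>
    integral {0..pi} (\<lambda>\<theta>. (sqrt (1 - u\<^sup>2) * cos \<theta>) ^ k * cos (of_int j * \<theta>)) / pi"
proof (induction k arbitrary: j)
  case 0
  have "\<forall>\<^sub>F N in sequentially. (if j = 0 then 1 else 0) = kr_fcalc N (\<lambda>s. 1) (X N + j) (X N)"
    using eventually_in_kr_nodes[OF X u] eventually_in_kr_nodes[OF of_int_shift_tendsto[OF X, of j] u]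
    by eventually_elim (simp only: kr_fcalc_one, auto)
  moreover have "integral {0..pi} (\<lambda>\<theta>. cos (of_int j * \<theta>)) / pi = (if j = 0 then 1 else 0)"
    using integral_unique[OF has_integral_cos_mult[of pi j]] by (auto simp: mult.commute[of _ pi])
  ultimately show ?case by (simp add: tendsto_eventually eventually_mono)
next
  case (Suc k)
  let ?c = "sqrt (1 - u\<^sup>2)"
  define I where "I j = integral {0..pi} (\<lambda>\<theta>. (?c * cos \<theta>) ^ k * cos (of_int j * \<theta>))" for j :: int
  have eq: "(?c * cos \<theta>) ^ Suc k * cos (of_int j * \<theta>) =
      ?c / 2 * ((?c * cos \<theta>) ^ k * cos (of_int (j + 1) * \<theta>) + (?c * cos \<theta>) ^ k * cos (of_int (j - 1) * \<theta>))" for \<theta>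
    by (simp add: distrib_right left_diff_distrib cos_add cos_diff algebra_simps)
  have "integral {0..pi} (\<lambda>\<theta>. (?c * cos \<theta>) ^ Suc k * cos (of_int j * \<theta>)) = ?c / 2 * (I (j + 1) + I (j - 1))"
    unfolding eq I_def
    by (subst integral_mult_right, subst integral_add)
       (auto intro!: integrable_continuous_real continuous_intros)
  then have lim: "integral {0..pi} (\<lambda>\<theta>. (?c * cos \<theta>) ^ Suc k * cos (of_int j * \<theta>)) / pi =
      ?c / 2 * (I (j + 1) / pi) + ?c / 2 * (I (j - 1) / pi)" by (simp add: field_simps)
  have "(\<lambda>N. kr_hop N (X N + j) * kr_fcalc N (\<lambda>s. s ^ k) (X N + (j + 1)) (X N) +
       kr_hop N (X N + (j - 1)) * kr_fcalc N (\<lambda>s. s ^ k) (X N + (j - 1)) (X N))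
       \<longlonglongrightarrow> ?c / 2 * (I (j + 1) / pi) + ?c / 2 * (I (j - 1) / pi)"
    unfolding I_def by (intro tendsto_intros kr_hop_tendsto of_int_shift_tendsto X Suc.IH)
  moreover have "\<forall>\<^sub>F N in sequentially. kr_hop N (X N + j) * kr_fcalc N (\<lambda>s. s ^ k) (X N + (j + 1)) (X N) +
       kr_hop N (X N + (j - 1)) * kr_fcalc N (\<lambda>s. s ^ k) (X N + (j - 1)) (X N) =
       kr_fcalc N (\<lambda>s. s ^ Suc k) (X N + j) (X N)"
    using eventually_in_kr_nodes[OF of_int_shift_tendsto[OF X, of j] u] eventually_gt_at_top[of 0]
    by eventually_elim (simp only: kr_fcalc_power_Suc, simp add: algebra_simps)
  ultimately show ?case unfolding lim by (rule Lim_transform_eventually)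
qed

lemma kr_fcalc_poly_tendsto:
  assumes \<kappa>: "continuous_on {0..pi} \<kappa>"
    and lim: "\<And>k. (\<lambda>N. kr_fcalc N (\<lambda>s. s ^ k) (X N) (Y N)) \<longlonglongrightarrow> kr_symbol c (\<lambda>s. s ^ k) \<kappa>"
  shows "(\<lambda>N. kr_fcalc N (poly q) (X N) (Y N)) \<longlonglongrightarrow> kr_symbol c (poly q) \<kappa>"
proof -
  have "integral {0..pi} (\<lambda>\<theta>. poly q (c * cos \<theta>) * \<kappa> \<theta>) =
      (\<Sum>i\<le>degree q. coeff q i * integral {0..pi} (\<lambda>\<theta>. (c * cos \<theta>) ^ i * \<kappa> \<theta>))"
    unfolding poly_altdef sum_distrib_right mult.assoc
    by (subst integral_sum) (auto intro!: integrable_continuous_real continuous_intros \<kappa>)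
  then have "kr_symbol c (poly q) \<kappa> = (\<Sum>i\<le>degree q. coeff q i * kr_symbol c (\<lambda>s. s ^ i) \<kappa>)"
    by (simp add: kr_symbol_def sum_divide_distrib)
  then show ?thesis unfolding kr_fcalc_poly by (auto intro!: tendsto_intros lim)
qed

section \<open>Convergence of spectral projections\<close>

text \<open>
  Left of \<open>\<phi>\<close> the argument \<open>c cos \<theta>\<close> is above the step and right of \<open>\<phi>\<close> it is below, so
  integrating the step function against \<open>\<kappa>\<close> just restricts the range to \<open>{0..\<phi>}\<close>.
\<close>

lemma kr_symbol_step_approx:
  assumes c: "0 < c" "c \<le> 1" and \<phi>: "0 < \<phi>" "\<phi> < pi" and \<delta>: "\<delta> > 0"
    and \<kappa>: "continuous_on {0..pi} \<kappa>" "\<And>\<theta>. \<bar>\<kappa> \<theta>\<bar> \<le> 1"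
    and approx: "\<And>s \<tau>. s \<in> {-1..1} \<Longrightarrow> \<bar>\<tau> - c * cos \<phi>\<bar> < \<delta> \<Longrightarrow> \<bar>of_bool (s > \<tau>) - poly q s\<bar> \<le> poly g s"
  shows "\<bar>kr_symbol c (poly q) \<kappa> - integral {0..\<phi>} \<kappa> / pi\<bar> \<le> kr_symbol c (poly g) (\<lambda>\<theta>. 1)"
proof -
  define Q G where "Q \<theta> = poly q (c * cos \<theta>)" and "G \<theta> = poly g (c * cos \<theta>)" for \<theta>
  have cont: "continuous_on S Q" "continuous_on S G" for S
    unfolding Q_def G_def by (intro continuous_intros)+
  have \<kappa>': "continuous_on {0..\<phi>} \<kappa>" "continuous_on {\<phi>..pi} \<kappa>"
    using \<phi> by (auto intro: continuous_on_subset[OF \<kappa>(1)])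
  have above: "\<bar>1 - poly q s\<bar> \<le> poly g s" if "s \<in> {-1..1}" "s \<ge> c * cos \<phi>" for s
    \<comment> \<open>The threshold is lowered since \<open>s\<close> may sit exactly at the step.\<close>
    using approx[of s "c * cos \<phi> - \<delta> / 2"] that \<delta> by simp
  have below: "\<bar>poly q s\<bar> \<le> poly g s" if "s \<in> {-1..1}" "s \<le> c * cos \<phi>" for s
    using approx[of s "c * cos \<phi>"] that \<delta> by simp
  have cin: "c * cos \<theta> \<in> {-1..1}" for \<theta>
  proof -
    have "\<bar>c * cos \<theta>\<bar> \<le> 1 * 1" unfolding abs_mult using c by (intro mult_mono) auto
    then show ?thesis by auto
  qed
  have mult_le: "\<bar>a * \<kappa> \<theta>\<bar> \<le> b" if "\<bar>a\<bar> \<le> b" for a b \<theta>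
    using mult_mono[OF that \<kappa>(2)[of \<theta>]] that by (simp add: abs_mult)
  have "norm (integral {0..\<phi>} (\<lambda>\<theta>. (1 - Q \<theta>) * \<kappa> \<theta>)) \<le> integral {0..\<phi>} G"
  proof (rule integral_norm_bound_integral)
    fix \<theta> assume \<theta>: "\<theta> \<in> {0..\<phi>}"
    then have "cos \<phi> \<le> cos \<theta>" using \<phi> by (intro cos_monotone_0_pi_le) auto
    then have "c * cos \<theta> \<ge> c * cos \<phi>" using c by simp
    then show "norm ((1 - Q \<theta>) * \<kappa> \<theta>) \<le> G \<theta>"
      unfolding Q_def G_def real_norm_def by (intro mult_le above cin)
  qed (intro integrable_continuous_real continuous_intros cont \<kappa>')+
  moreover have "integral {0..\<phi>} (\<lambda>\<theta>. (1 - Q \<theta>) * \<kappa> \<theta>) = integral {0..\<phi>} \<kappa> - integral {0..\<phi>} (\<lambda>\<theta>. Q \<theta> * \<kappa> \<theta>)"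
    unfolding left_diff_distrib mult_1
    by (intro integral_diff integrable_continuous_real continuous_intros cont \<kappa>')
  moreover have "norm (integral {\<phi>..pi} (\<lambda>\<theta>. Q \<theta> * \<kappa> \<theta>)) \<le> integral {\<phi>..pi} G"
  proof (rule integral_norm_bound_integral)
    fix \<theta> assume \<theta>: "\<theta> \<in> {\<phi>..pi}"
    then have "cos \<theta> \<le> cos \<phi>" using \<phi> by (intro cos_monotone_0_pi_le) auto
    then have "c * cos \<theta> \<le> c * cos \<phi>" using c by simp
    then show "norm (Q \<theta> * \<kappa> \<theta>) \<le> G \<theta>"
      unfolding Q_def G_def real_norm_def by (intro mult_le below cin)
  qed (intro integrable_continuous_real continuous_intros cont \<kappa>')+
  moreover have "integral {0..\<phi>} (\<lambda>\<theta>. Q \<theta> * \<kappa> \<theta>) + integral {\<phi>..pi} (\<lambda>\<theta>. Q \<theta> * \<kappa> \<theta>) = integral {0..pi} (\<lambda>\<theta>. Q \<theta> * \<kappa> \<theta>)"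
    using \<phi> by (intro Henstock_Kurzweil_Integration.integral_combine integrable_continuous_real continuous_intros cont \<kappa>) auto
  moreover have "integral {0..\<phi>} G + integral {\<phi>..pi} G = integral {0..pi} G"
    using \<phi> by (intro Henstock_Kurzweil_Integration.integral_combine integrable_continuous_real cont) auto
  ultimately have "\<bar>integral {0..pi} (\<lambda>\<theta>. Q \<theta> * \<kappa> \<theta>) - integral {0..\<phi>} \<kappa>\<bar> \<le> integral {0..pi} G"
    unfolding real_norm_def by linarith
  then have "\<bar>integral {0..pi} (\<lambda>\<theta>. Q \<theta> * \<kappa> \<theta>) - integral {0..\<phi>} \<kappa>\<bar> / pi \<le> integral {0..pi} G / pi"
    by (intro divide_right_mono) auto
  then show ?thesis
    by (simp add: kr_symbol_def Q_def G_def[abs_def] abs_divide flip: diff_divide_distrib)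
qed

text \<open>
  Convergence of moments passes to the spectral projection. Stated for an arbitrary limit \<open>\<kappa>\<close> of the
  mixed moments, so that it serves both for nodes at bounded distance and for nodes that move apart;
  the diagonal moments at both points are needed to control the error.
\<close>

lemma kr_cd_tendsto:
  assumes c: "0 < c" "c \<le> 1" and \<phi>: "0 < \<phi>" "\<phi> < pi"
    and M: "(\<lambda>N. real (M N) / real N) \<longlonglongrightarrow> 1 - c * cos \<phi>" "\<forall>\<^sub>F N in sequentially. M N \<le> 2 * N + 1"
    and \<kappa>: "continuous_on {0..pi} \<kappa>" "\<And>\<theta>. \<bar>\<kappa> \<theta>\<bar> \<le> 1"
    and XY: "\<And>k. (\<lambda>N. kr_fcalc N (\<lambda>s. s ^ k) (X N) (Y N)) \<longlonglongrightarrow> kr_symbol c (\<lambda>s. s ^ k) \<kappa>"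
    and XX: "\<And>k. (\<lambda>N. kr_fcalc N (\<lambda>s. s ^ k) (X N) (X N)) \<longlonglongrightarrow> kr_symbol c (\<lambda>s. s ^ k) (\<lambda>\<theta>. 1)"
    and YY: "\<And>k. (\<lambda>N. kr_fcalc N (\<lambda>s. s ^ k) (Y N) (Y N)) \<longlonglongrightarrow> kr_symbol c (\<lambda>s. s ^ k) (\<lambda>\<theta>. 1)"
  shows "(\<lambda>N. kr_cd N 0 (M N) (X N) (Y N)) \<longlonglongrightarrow> integral {0..\<phi>} \<kappa> / pi"
proof (rule tendstoI)
  fix \<epsilon> :: real assume \<epsilon>: "\<epsilon> > 0"
  obtain q g :: "real poly" and \<delta> where \<delta>: "\<delta> > 0"
    and approx: "\<And>s \<tau>. s \<in> {-1..1} \<Longrightarrow> \<bar>\<tau> - c * cos \<phi>\<bar> < \<delta> \<Longrightarrow>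
       \<bar>of_bool (s > \<tau>) - poly q s\<bar> \<le> poly g s \<and> \<bar>of_bool (s > \<tau>) - poly q s\<bar> \<le> 2"
    and g: "kr_symbol c (poly g) (\<lambda>\<theta>. 1) \<le> \<epsilon> / 4"
    using step_polynomial_approx[OF c \<phi>, of "\<epsilon> / 4"] \<epsilon> by (metis divide_pos_pos zero_less_numeral)
  have lim_q: "\<bar>kr_symbol c (poly q) \<kappa> - integral {0..\<phi>} \<kappa> / pi\<bar> \<le> \<epsilon> / 4"
    using kr_symbol_step_approx[OF c \<phi> \<delta> \<kappa>] approx g by (meson order_trans)
  have XX': "(\<lambda>N. kr_fcalc N (poly g) (X N) (X N)) \<longlonglongrightarrow> kr_symbol c (poly g) (\<lambda>\<theta>. 1)"
    and YY': "(\<lambda>N. kr_fcalc N (poly g) (Y N) (Y N)) \<longlonglongrightarrow> kr_symbol c (poly g) (\<lambda>\<theta>. 1)"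
    and XY': "(\<lambda>N. kr_fcalc N (poly q) (X N) (Y N)) \<longlonglongrightarrow> kr_symbol c (poly q) \<kappa>"
    by (intro kr_fcalc_poly_tendsto XX YY XY \<kappa>(1) continuous_intros)+
  have "(\<lambda>N. 1 - real (M N) / real N) \<longlonglongrightarrow> 1 - (1 - c * cos \<phi>)"
    by (intro tendsto_intros M)
  then have "(\<lambda>N. 1 - real (M N) / real N) \<longlonglongrightarrow> c * cos \<phi>" by simp
  from tendstoD[OF this \<delta>] have "\<forall>\<^sub>F N in sequentially. \<bar>1 - real (M N) / real N - c * cos \<phi>\<bar> < \<delta>"
    by (simp add: dist_real_def)
  moreover have "\<forall>\<^sub>F N in sequentially. kr_fcalc N (poly g) (X N) (X N) < \<epsilon> / 2"
    by (rule order_tendstoD(2)[OF XX']) (use g \<epsilon> in linarith)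
  moreover have "\<forall>\<^sub>F N in sequentially. kr_fcalc N (poly g) (Y N) (Y N) < \<epsilon> / 2"
    by (rule order_tendstoD(2)[OF YY']) (use g \<epsilon> in linarith)
  moreover have "\<forall>\<^sub>F N in sequentially. \<bar>kr_fcalc N (poly q) (X N) (Y N) - kr_symbol c (poly q) \<kappa>\<bar> < \<epsilon> / 4"
    using tendstoD[OF XY', of "\<epsilon> / 4"] \<epsilon> by (simp add: dist_real_def)
  ultimately show "\<forall>\<^sub>F N in sequentially. dist (kr_cd N 0 (M N) (X N) (Y N)) (integral {0..\<phi>} \<kappa> / pi) < \<epsilon>"
    using M(2) eventually_gt_at_top[of 0]
  proof eventually_elim
    case (elim N)
    have "\<bar>of_bool (s > 1 - real (M N) / real N) - poly q s\<bar> \<le> poly g s" if "s \<in> {-1..1}" for s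
      using approx[OF that elim(1)] by simp
    then have "\<bar>kr_cd N 0 (M N) (X N) (Y N) - kr_fcalc N (poly q) (X N) (Y N)\<bar> \<le>
        (kr_fcalc N (poly g) (X N) (X N) + kr_fcalc N (poly g) (Y N) (Y N)) / 2"
      unfolding kr_cd_eq_fcalc[OF elim(6) elim(5)] by (rule kr_fcalc_diff_le)
    moreover have "\<bar>a - l\<bar> < \<epsilon>"
      if "\<bar>a - b\<bar> \<le> (g1 + g2) / 2" "g1 < \<epsilon> / 2" "g2 < \<epsilon> / 2" "\<bar>b - s\<bar> < \<epsilon> / 4" "\<bar>s - l\<bar> \<le> \<epsilon> / 4"
      for a b g1 g2 s l :: real
    proof -
      have "\<bar>a - l\<bar> \<le> \<bar>a - b\<bar> + \<bar>b - s\<bar> + \<bar>s - l\<bar>" by linarith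
      with that show ?thesis by argo
    qed
    ultimately show ?case using elim(2-4) lim_q unfolding dist_real_def by blast
  qed
qed

text \<open>
  Beyond distance \<open>k = degree q\<close> the entries of \<open>q(J)\<close> vanish, so there the row of the projection
  coincides with the row of the projection minus \<open>q(J)\<close>, whose full norm is small.
\<close>

lemma kr_cd_tail:
  assumes c: "0 < c" "c \<le> 1" and \<phi>: "0 < \<phi>" "\<phi> < pi"
    and M: "(\<lambda>N. real (M N) / real N) \<longlonglongrightarrow> 1 - c * cos \<phi>" "\<forall>\<^sub>F N in sequentially. M N \<le> 2 * N + 1"
    and X: "\<forall>\<^sub>F N in sequentially. X N \<in> kr_nodes N"
    and XX: "\<And>k. (\<lambda>N. kr_fcalc N (\<lambda>s. s ^ k) (X N) (X N)) \<longlonglongrightarrow> kr_symbol c (\<lambda>s. s ^ k) (\<lambda>\<theta>. 1)"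
    and \<epsilon>: "\<epsilon> > 0"
  obtains k :: nat where "\<forall>\<^sub>F N in sequentially.
    (\<Sum>y | y \<in> kr_nodes N \<and> \<bar>X N - y\<bar> > int k. (kr_cd N 0 (M N) (X N) y)\<^sup>2) \<le> \<epsilon>"
proof -
  obtain q g :: "real poly" and \<delta> where \<delta>: "\<delta> > 0"
    and approx: "\<And>s \<tau>. s \<in> {-1..1} \<Longrightarrow> \<bar>\<tau> - c * cos \<phi>\<bar> < \<delta> \<Longrightarrow>
       \<bar>of_bool (s > \<tau>) - poly q s\<bar> \<le> poly g s \<and> \<bar>of_bool (s > \<tau>) - poly q s\<bar> \<le> 2"
    and g: "kr_symbol c (poly g) (\<lambda>\<theta>. 1) \<le> \<epsilon> / 4"
    using step_polynomial_approx[OF c \<phi>, of "\<epsilon> / 4"] \<epsilon> by (metis divide_pos_pos zero_less_numeral)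
  have XX': "(\<lambda>N. kr_fcalc N (poly g) (X N) (X N)) \<longlonglongrightarrow> kr_symbol c (poly g) (\<lambda>\<theta>. 1)"
    by (intro kr_fcalc_poly_tendsto XX continuous_intros)
  have "(\<lambda>N. 1 - real (M N) / real N) \<longlonglongrightarrow> 1 - (1 - c * cos \<phi>)"
    by (intro tendsto_intros M)
  then have "(\<lambda>N. 1 - real (M N) / real N) \<longlonglongrightarrow> c * cos \<phi>" by simp
  from tendstoD[OF this \<delta>] have "\<forall>\<^sub>F N in sequentially. \<bar>1 - real (M N) / real N - c * cos \<phi>\<bar> < \<delta>"
    by (simp add: dist_real_def)
  moreover have "\<forall>\<^sub>F N in sequentially. kr_fcalc N (poly g) (X N) (X N) < \<epsilon> / 2"
    by (rule order_tendstoD(2)[OF XX']) (use g \<epsilon> in linarith)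
  ultimately have "\<forall>\<^sub>F N in sequentially.
    (\<Sum>y | y \<in> kr_nodes N \<and> \<bar>X N - y\<bar> > int (degree q). (kr_cd N 0 (M N) (X N) y)\<^sup>2) \<le> \<epsilon>"
    using M(2) eventually_gt_at_top[of 0] X
  proof eventually_elim
    case (elim N)
    let ?e = "\<lambda>s. of_bool (s > 1 - real (M N) / real N) - poly q s"
    have e: "(?e s)\<^sup>2 \<le> 2 * poly g s" if "s \<in> {-1..1}" for s
    proof -
      have "\<bar>?e s\<bar> \<le> poly g s \<and> \<bar>?e s\<bar> \<le> 2" by (rule approx[OF that elim(1)])
      then have "\<bar>?e s\<bar> * \<bar>?e s\<bar> \<le> 2 * poly g s" by (intro mult_mono) auto
      then show ?thesis by (simp add: power2_eq_square)
    qed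
    have "(\<Sum>y | y \<in> kr_nodes N \<and> \<bar>X N - y\<bar> > int (degree q). (kr_cd N 0 (M N) (X N) y)\<^sup>2) =
        (\<Sum>y | y \<in> kr_nodes N \<and> \<bar>X N - y\<bar> > int (degree q). (kr_fcalc N ?e (X N) y)\<^sup>2)"
    proof (intro sum.cong refl)
      fix y assume "y \<in> {y. y \<in> kr_nodes N \<and> \<bar>X N - y\<bar> > int (degree q)}"
      then have "kr_fcalc N (poly q) (X N) y = 0"
        by (intro kr_fcalc_poly_local elim) auto
      then have "kr_fcalc N ?e (X N) y = kr_cd N 0 (M N) (X N) y"
        unfolding kr_cd_eq_fcalc[OF elim(4) elim(3)]
        by (simp add: kr_fcalc_def left_diff_distrib sum_subtractf)
      then show "(kr_cd N 0 (M N) (X N) y)\<^sup>2 = (kr_fcalc N ?e (X N) y)\<^sup>2" by simp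
    qed
    also have "\<dots> \<le> kr_ip N (kr_fcalc N ?e (X N)) (kr_fcalc N ?e (X N))"
      unfolding kr_ip_def power2_eq_square by (intro sum_mono2) auto
    also have "\<dots> \<le> kr_fcalc N (\<lambda>s. 2 * poly g s) (X N) (X N)"
      unfolding kr_fcalc_row_norm by (rule kr_fcalc_diag_mono[OF e])
    also have "\<dots> = 2 * kr_fcalc N (poly g) (X N) (X N)"
      by (simp add: kr_fcalc_def sum_distrib_left mult_ac)
    also have "\<dots> \<le> \<epsilon>" using elim(2) by simp
    finally show ?case .
  qed
  then show thesis by (rule that)
qed

section \<open>Norm of the test function\<close>

text \<open>
  The factor \<open>(y / x)\<^sup>d\<close> is close to \<open>1\<close> in modulus near the diagonal, and at most \<open>(N / \<bar>x\<bar>)\<^sup>d\<close>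
  elsewhere, where the kernel has little mass.
\<close>

lemma kr_test_function_norm_le:
  fixes k d :: nat
  assumes M: "M \<le> 2 * N + 1" and x: "x \<noteq> 0" "x \<in> kr_nodes N"
  defines "f \<equiv> (\<lambda>y. (1 / of_int x) ^ d * of_int y ^ d * kr_cd N 0 M x y)"
  shows "kr_ip N f f \<le> (1 + real k / of_int \<bar>x\<bar>) ^ (2 * d) * kr_cd N 0 M x x +
    (real N / of_int \<bar>x\<bar>) ^ (2 * d) * (\<Sum>y | y \<in> kr_nodes N \<and> \<bar>x - y\<bar> > int k. (kr_cd N 0 M x y)\<^sup>2)"
proof -
  let ?K = "kr_cd N 0 M x"
  let ?a = "(1 + real k / of_int \<bar>x\<bar>) ^ (2 * d)" and ?b = "(real N / of_int \<bar>x\<bar>) ^ (2 * d)"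
  have "f y * f y \<le> ?a * (?K y * ?K y) + (if \<bar>x - y\<bar> > int k then ?b * (?K y)\<^sup>2 else 0)"
    if y: "y \<in> kr_nodes N" for y
  proof -
    define r where "r = real_of_int \<bar>y\<bar> / of_int \<bar>x\<bar>"
    have r0: "0 \<le> r" by (simp add: r_def)
    have "f y * f y = ((of_int y / of_int x) ^ d)\<^sup>2 * (?K y)\<^sup>2"
      by (simp add: f_def power2_eq_square power_divide mult_ac)
    also have "((of_int y / of_int x) ^ d)\<^sup>2 = r ^ (2 * d)"
    proof -
      have "r ^ d = \<bar>(of_int y / of_int x) ^ d\<bar>" by (simp add: r_def power_abs)
      then show ?thesis by (metis power2_abs power_even_eq)
    qed
    finally have f: "f y * f y = r ^ (2 * d) * (?K y)\<^sup>2" .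
    show ?thesis
    proof (cases "\<bar>x - y\<bar> > int k")
      case True
      have "r \<le> real N / of_int \<bar>x\<bar>" unfolding r_def using y by (intro divide_right_mono) auto
      then have "r ^ (2 * d) * (?K y)\<^sup>2 \<le> ?b * (?K y)\<^sup>2" using r0 by (intro mult_right_mono power_mono) auto
      moreover have "0 \<le> ?a * (?K y * ?K y)" by simp
      ultimately show ?thesis unfolding f using True by (simp only: if_True)
    next
      case False
      then have "\<bar>y\<bar> \<le> \<bar>x\<bar> + int k" by linarith
      then have "real_of_int \<bar>y\<bar> \<le> of_int \<bar>x\<bar> + real k" by linarith
      then have "r \<le> (of_int \<bar>x\<bar> + real k) / of_int \<bar>x\<bar>"
        unfolding r_def by (intro divide_right_mono) auto
      also have "\<dots> = 1 + real k / of_int \<bar>x\<bar>" using x(1) by (simp add: add_divide_distrib)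
      finally have "r \<le> 1 + real k / of_int \<bar>x\<bar>" .
      then have "r ^ (2 * d) * (?K y)\<^sup>2 \<le> ?a * (?K y)\<^sup>2" using r0 by (intro mult_right_mono power_mono) auto
      then show ?thesis unfolding f using False by (simp add: power2_eq_square)
    qed
  qed
  then have "kr_ip N f f \<le> (\<Sum>y\<in>kr_nodes N. ?a * (?K y * ?K y) + (if \<bar>x - y\<bar> > int k then ?b * (?K y)\<^sup>2 else 0))"
    unfolding kr_ip_def by (rule sum_mono)
  also have "\<dots> = ?a * kr_ip N ?K ?K + ?b * (\<Sum>y | y \<in> kr_nodes N \<and> \<bar>x - y\<bar> > int k. (?K y)\<^sup>2)"
  proof -
    have "(\<Sum>y\<in>kr_nodes N. if \<bar>x - y\<bar> > int k then ?b * (?K y)\<^sup>2 else 0) =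
        (\<Sum>y | y \<in> kr_nodes N \<and> \<bar>x - y\<bar> > int k. ?b * (?K y)\<^sup>2)"
      by (rule sum.inter_filter[symmetric]) simp
    then show ?thesis unfolding kr_ip_def sum.distrib sum_distrib_left by simp
  qed
  also have "kr_ip N ?K ?K = ?K x" using M by (intro kr_cd_idem) (simp add: kr_dim_def)
  finally show ?thesis .
qed

section \<open>Reflection symmetry\<close>

lemma kr_weight_minus:
  assumes "x \<in> kr_nodes N"
  shows "kr_weight N (- x) = kr_weight N x"
proof -
  define k where "k = nat (int N + x)"
  have "k \<le> 2 * N" "nat (int N - x) = 2 * N - k" using assms by (auto simp: k_def)
  then show ?thesis using binomial_symmetric[of k "2 * N"] by (simp add: kr_weight_def k_def)
qed

lemma sum_kr_nodes_minus: "(\<Sum>x\<in>kr_nodes N. F (- x)) = (\<Sum>x\<in>kr_nodes N. F x)"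
  by (rule sum.reindex_bij_witness[where i = uminus and j = uminus]) auto

text \<open>
  The weight is even, so the reflected polynomial satisfies the same characterisation up to the sign
  of its leading coefficient.
\<close>

lemma kr_poly_minus:
  assumes m: "m < kr_dim N d"
  shows "poly (kr_poly N d m) (- x) = (-1) ^ m * poly (kr_poly N d m) x"
proof -
  let ?P = "kr_poly N d m"
  let ?R = "smult ((-1) ^ m) (?P \<circ>\<^sub>p [:0, -1:])"
  have orth: "is_monic_orth_poly (kr_nodes N) (kr_weight_d N d) m ?P" by (rule kr_poly_orth[OF m])
  have w: "kr_weight_d N d (- x) = kr_weight_d N d x" if "x \<in> kr_nodes N" for x
    using kr_weight_minus[OF that] by (simp add: kr_weight_d_def)
  have "is_monic_orth_poly (kr_nodes N) (kr_weight_d N d) m ?R"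
    unfolding is_monic_orth_poly_def
  proof (intro conjI allI impI)
    show "degree ?R = m" using orth by (simp add: is_monic_orth_poly_def degree_pcompose)
    have "lead_coeff (?P \<circ>\<^sub>p [:0, -1:]) = (-1) ^ m"
      using orth by (subst lead_coeff_comp) (auto simp: is_monic_orth_poly_def)
    then show "lead_coeff ?R = 1" by (simp add: lead_coeff_smult flip: power_mult_distrib)
    fix Q :: "real poly" assume Q: "degree Q < m"
    have "(\<Sum>x\<in>kr_nodes N. poly ?R (of_int x) * poly Q (of_int x) * kr_weight_d N d x) =
        (-1) ^ m * (\<Sum>x\<in>kr_nodes N. poly ?P (of_int (- x)) * poly (Q \<circ>\<^sub>p [:0, -1:]) (of_int (- x)) * kr_weight_d N d (- x))"
      unfolding sum_distrib_left by (intro sum.cong refl) (simp add: w poly_pcompose)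
    also have "\<dots> = (-1) ^ m * (\<Sum>x\<in>kr_nodes N. poly ?P (of_int x) * poly (Q \<circ>\<^sub>p [:0, -1:]) (of_int x) * kr_weight_d N d x)"
      by (subst sum_kr_nodes_minus) (rule refl)
    also have "\<dots> = 0" using orth Q by (simp add: is_monic_orth_poly_def degree_pcompose)
    finally show "(\<Sum>x\<in>kr_nodes N. poly ?R (of_int x) * poly Q (of_int x) * kr_weight_d N d x) = 0" .
  qed
  moreover have "\<exists>!P. is_monic_orth_poly (kr_nodes N) (kr_weight_d N d) m P"
  proof (rule ex1_monic_orth_poly)
    show "m \<le> card {x \<in> kr_nodes N. kr_weight_d N d x > 0}"
      unfolding kr_weight_d_support using m by (auto simp: kr_dim_def split: if_splits)
  qed (simp_all add: kr_weight_d_def kr_weight_nonneg power_mult)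
  ultimately have "?P = ?R" using orth by blast
  then have "poly ?P (- x) = poly ?R (- x)" by simp
  then show ?thesis by (simp add: poly_pcompose)
qed

lemma kr_fun_minus:
  assumes "m < kr_dim N d" "x \<in> kr_nodes N"
  shows "kr_fun N d m (- x) = (-1) ^ (m + d) * kr_fun N d m x"
proof -
  have "(- real_of_int x) ^ d = (-1) ^ d * of_int x ^ d" by (rule power_minus)
  then show ?thesis
    using kr_poly_minus[OF assms(1), of "of_int x"] kr_weight_minus[OF assms(2)]
    by (simp add: kr_fun_def power_add)
qed

text \<open>
  Adding the reflected term doubles the even degrees and cancels the odd ones. The factor
  \<open>(-1) ^ d\<close> compensates the parity of \<open>x\<^sup>d\<close>; the factors \<open>\<eta>\<close> are \<open>1\<close> away from the origin.
\<close>

lemma kr_kernel_eq_cd: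
  assumes n: "2 * n \<le> kr_dim N d" and x: "x \<noteq> 0" and y: "y \<noteq> 0" "y \<in> kr_nodes N"
  shows "kr_kernel N d n x y = kr_cd N d (2 * n) x y + (-1) ^ d * kr_cd N d (2 * n) x (- y)"
proof -
  have even_terms: "(\<Sum>m<2 * n. (1 + (-1) ^ m) * g m) = 2 * (\<Sum>l<n. g (2 * l))" for g :: "nat \<Rightarrow> real" and n
    by (induction n) (simp_all add: algebra_simps)
  have "kr_cd N d (2 * n) x y + (-1) ^ d * kr_cd N d (2 * n) x (- y) =
      (\<Sum>m<2 * n. (1 + (-1) ^ m) * (kr_fun N d m x * kr_fun N d m y))"
    unfolding kr_cd_def sum_distrib_left sum.distrib[symmetric]
  proof (intro sum.cong refl)
    fix m assume "m \<in> {..<2 * n}"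
    then have "kr_fun N d m (- y) = (-1) ^ (m + d) * kr_fun N d m y"
      using n y by (intro kr_fun_minus) auto
    moreover have "(-1) ^ d * (-1) ^ (m + d) = ((-1) ^ m :: real)"
      by (simp add: power_add flip: power_mult_distrib)
    ultimately show "kr_fun N d m x * kr_fun N d m y + (-1) ^ d * (kr_fun N d m x * kr_fun N d m (- y)) =
        (1 + (-1) ^ m) * (kr_fun N d m x * kr_fun N d m y)" by (simp add: algebra_simps)
  qed
  also have "\<dots> = 2 * (\<Sum>l<n. kr_fun N d (2 * l) x * kr_fun N d (2 * l) y)" by (rule even_terms)
  also have "\<dots> = kr_kernel N d n x y" using x y by (simp add: kr_kernel_def kr_eta_def)
  finally show ?thesis by simp
qed

section \<open>The bulk limit\<close>

lemma kr_fcalc_power_tendsto_bulk: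
  assumes X: "(\<lambda>N. of_int (X N) / real N) \<longlonglongrightarrow> u" and u: "\<bar>u\<bar> < 1"
  shows "(\<lambda>N. kr_fcalc N (\<lambda>s. s ^ k) (X N + A) (X N + B)) \<longlonglongrightarrow>
    kr_symbol (sqrt (1 - u\<^sup>2)) (\<lambda>s. s ^ k) (\<lambda>\<theta>. cos (of_int (A - B) * \<theta>))"
  using kr_fcalc_power_tendsto[OF of_int_shift_tendsto[OF X, of B] u, of k "A - B"]
  by (simp add: kr_symbol_def)

lemma kr_fcalc_power_tendsto_far:
  assumes X: "(\<lambda>N. of_int (X N) / real N) \<longlonglongrightarrow> u" and Y: "(\<lambda>N. of_int (Y N) / real N) \<longlonglongrightarrow> v"
    and u: "\<bar>u\<bar> < 1" "\<bar>v\<bar> < 1" "u \<noteq> v"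
  shows "(\<lambda>N. kr_fcalc N (\<lambda>s. s ^ k) (X N) (Y N)) \<longlonglongrightarrow> kr_symbol c (\<lambda>s. s ^ k) (\<lambda>\<theta>. 0)"
proof -
  have "(\<lambda>N. \<bar>of_int (X N) / real N - of_int (Y N) / real N\<bar> - real k / real N) \<longlonglongrightarrow> \<bar>u - v\<bar> - 0"
    by (intro tendsto_intros X Y lim_const_over_n)
  then have "\<forall>\<^sub>F N in sequentially. \<bar>of_int (X N) / real N - of_int (Y N) / real N\<bar> - real k / real N > 0"
    using u(3) by (intro order_tendstoD(1)) auto
  then have "\<forall>\<^sub>F N in sequentially. kr_fcalc N (\<lambda>s. s ^ k) (X N) (Y N) = 0"
    using eventually_in_kr_nodes[OF X u(1)] eventually_in_kr_nodes[OF Y u(2)] eventually_gt_at_top[of 0]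
  proof eventually_elim
    case (elim N)
    have "\<bar>of_int (X N) / real N - of_int (Y N) / real N\<bar> = of_int \<bar>X N - Y N\<bar> / real N"
      by (simp flip: diff_divide_distrib)
    then have "real k / real N < of_int \<bar>X N - Y N\<bar> / real N" using elim(1) by simp
    then have "real k < of_int \<bar>X N - Y N\<bar>" using elim(4) by (simp only: divide_less_cancel)
    then have "\<bar>X N - Y N\<bar> > int k" by linarith
    then show ?case using elim by (intro kr_fcalc_power_local) auto
  qed
  then show ?thesis by (simp add: kr_symbol_def tendsto_eventually)
qed

text \<open>
  A macroscopic position \<open>u\<close> away from the origin and from the end points, and an angle \<open>\<phi>\<close>, which
  corresponds to a fraction \<open>1 - c cos \<phi>\<close> of degrees per \<open>N\<close>.
\<close>

locale kr_bulk =
  fixes u \<phi> :: real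
  assumes u: "0 < \<bar>u\<bar>" "\<bar>u\<bar> < 1" and \<phi>: "0 < \<phi>" "\<phi> < pi"
begin

definition c :: real where "c = sqrt (1 - u\<^sup>2)"

lemma c_bounds: "0 < c" "c \<le> 1"
  using u(2) by (auto simp: c_def abs_square_less_1)

lemma kr_cd_bulk:
  assumes M: "(\<lambda>N. real (M N) / real N) \<longlonglongrightarrow> 1 - c * cos \<phi>" "\<forall>\<^sub>F N in sequentially. M N \<le> 2 * N + 1"
    and X: "(\<lambda>N. of_int (X N) / real N) \<longlonglongrightarrow> u"
  shows "(\<lambda>N. kr_cd N 0 (M N) (X N + A) (X N + B)) \<longlonglongrightarrow> discrete_sine_kernel \<phi> A B"
proof -
  have "(\<lambda>N. kr_cd N 0 (M N) (X N + A) (X N + B)) \<longlonglongrightarrow> integral {0..\<phi>} (\<lambda>\<theta>. cos (of_int (A - B) * \<theta>)) / pi"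
  proof (rule kr_cd_tendsto[OF c_bounds \<phi> M])
    show "(\<lambda>N. kr_fcalc N (\<lambda>s. s ^ k) (X N + A) (X N + B)) \<longlonglongrightarrow> kr_symbol c (\<lambda>s. s ^ k) (\<lambda>\<theta>. cos (of_int (A - B) * \<theta>))" for k
      using kr_fcalc_power_tendsto_bulk[OF X u(2)] by (simp add: c_def)
    show "(\<lambda>N. kr_fcalc N (\<lambda>s. s ^ k) (X N + A) (X N + A)) \<longlonglongrightarrow> kr_symbol c (\<lambda>s. s ^ k) (\<lambda>\<theta>. 1)" for k A
      using kr_fcalc_power_tendsto_bulk[OF X u(2), of k A A] by (simp add: c_def)
    show "(\<lambda>N. kr_fcalc N (\<lambda>s. s ^ k) (X N + B) (X N + B)) \<longlonglongrightarrow> kr_symbol c (\<lambda>s. s ^ k) (\<lambda>\<theta>. 1)" for k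
      using kr_fcalc_power_tendsto_bulk[OF X u(2), of k B B] by (simp add: c_def)
  qed (auto intro!: continuous_intros)
  moreover have "integral {0..\<phi>} (\<lambda>\<theta>. cos (of_int (A - B) * \<theta>)) / pi = discrete_sine_kernel \<phi> A B"
    using integral_unique[OF has_integral_cos_mult[of \<phi> "A - B"]] \<phi>
    by (simp add: discrete_sine_kernel_def mult_ac)
  ultimately show ?thesis by simp
qed

lemma kr_cd_far:
  assumes M: "(\<lambda>N. real (M N) / real N) \<longlonglongrightarrow> 1 - c * cos \<phi>" "\<forall>\<^sub>F N in sequentially. M N \<le> 2 * N + 1"
    and X: "(\<lambda>N. of_int (X N) / real N) \<longlonglongrightarrow> u" and Y: "(\<lambda>N. of_int (Y N) / real N) \<longlonglongrightarrow> - u"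
  shows "(\<lambda>N. kr_cd N 0 (M N) (X N) (Y N)) \<longlonglongrightarrow> 0"
proof -
  have "(\<lambda>N. kr_cd N 0 (M N) (X N) (Y N)) \<longlonglongrightarrow> integral {0..\<phi>} (\<lambda>\<theta>. 0) / pi"
  proof (rule kr_cd_tendsto[OF c_bounds \<phi> M])
    show "(\<lambda>N. kr_fcalc N (\<lambda>s. s ^ k) (X N) (Y N)) \<longlonglongrightarrow> kr_symbol c (\<lambda>s. s ^ k) (\<lambda>\<theta>. 0)" for k
      using u by (intro kr_fcalc_power_tendsto_far[OF X Y]) auto
    show "(\<lambda>N. kr_fcalc N (\<lambda>s. s ^ k) (X N) (X N)) \<longlonglongrightarrow> kr_symbol c (\<lambda>s. s ^ k) (\<lambda>\<theta>. 1)" for k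
      using kr_fcalc_power_tendsto_bulk[OF X u(2), of k 0 0] by (simp add: c_def)
    show "(\<lambda>N. kr_fcalc N (\<lambda>s. s ^ k) (Y N) (Y N)) \<longlonglongrightarrow> kr_symbol c (\<lambda>s. s ^ k) (\<lambda>\<theta>. 1)" for k
      using kr_fcalc_power_tendsto_bulk[OF Y, of k 0 0] u by (simp add: c_def)
  qed auto
  then show ?thesis by simp
qed

text \<open>
  \<open>kr_cd_comparison\<close> with the test function \<open>f y = (y / x)\<^sup>d K x y\<close>, where \<open>K\<close> is the undeformed
  kernel of degree below \<open>M N\<close>. Each of \<open>K\<^sub>V x x\<close>, \<open>f x = K x x\<close> and, up to an arbitrarily small
  tail, \<open>\<parallel>f\<parallel>\<^sup>2\<close> tends to \<open>s = \<phi> / \<pi>\<close>, so the bound tends to \<open>s - 2 s + s = 0\<close>.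
\<close>

lemma kr_cd_deformation_negligible:
  assumes M: "(\<lambda>N. real (M N) / real N) \<longlonglongrightarrow> 1 - c * cos \<phi>" "\<forall>\<^sub>F N in sequentially. M N + d \<le> 2 * N"
    and X: "(\<lambda>N. of_int (X N) / real N) \<longlonglongrightarrow> u" and Y: "\<forall>\<^sub>F N in sequentially. Y N \<in> kr_nodes N"
  shows "(\<lambda>N. kr_cd N d (M N) (X N) (Y N) - kr_cd N 0 (M N + d) (X N) (Y N)) \<longlonglongrightarrow> 0"
proof (rule tendstoI)
  fix \<epsilon> :: real assume \<epsilon>: "\<epsilon> > 0"
  define s where "s = \<phi> / pi"
  have s: "discrete_sine_kernel \<phi> 0 0 = s" by (simp add: s_def discrete_sine_kernel_def)
  have Xn: "\<forall>\<^sub>F N in sequentially. X N \<in> kr_nodes N" by (rule eventually_in_kr_nodes[OF X u(2)])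
  have M1: "\<forall>\<^sub>F N in sequentially. M N \<le> 2 * N + 1" using M(2) by (auto elim: eventually_mono)
  have M2: "\<forall>\<^sub>F N in sequentially. M N + d \<le> 2 * N + 1" using M(2) by (auto elim: eventually_mono)
  have Md: "(\<lambda>N. real (M N + d) / real N) \<longlonglongrightarrow> 1 - c * cos \<phi>"
    using tendsto_add[OF M(1) lim_const_over_n[of "real d"]] by (simp add: add_divide_distrib)
  have lim1: "(\<lambda>N. kr_cd N 0 (M N) (X N) (X N)) \<longlonglongrightarrow> s"
    using kr_cd_bulk[OF M(1) M1 X, of 0 0] by (simp add: s)
  have lim2: "(\<lambda>N. kr_cd N 0 (M N + d) (X N) (X N)) \<longlonglongrightarrow> s"
    using kr_cd_bulk[OF Md M2 X, of 0 0] by (simp add: s)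
  \<comment> \<open>The tail will be multiplied by a factor tending to \<open>\<bar>u\<bar> ^ (-2 d)\<close>,
      and the square of the difference has to be below \<open>\<epsilon>\<^sup>2\<close>.\<close>
  define \<epsilon>' where "\<epsilon>' = \<epsilon>\<^sup>2 * \<bar>u\<bar> ^ (2 * d) / 2"
  have \<epsilon>': "\<epsilon>' > 0" using \<epsilon> u by (simp add: \<epsilon>'_def)
  have XX: "(\<lambda>N. kr_fcalc N (\<lambda>s. s ^ k) (X N) (X N)) \<longlonglongrightarrow> kr_symbol c (\<lambda>s. s ^ k) (\<lambda>\<theta>. 1)" for k
    using kr_fcalc_power_tendsto_bulk[OF X u(2), of k 0 0] by (simp add: c_def)
  obtain k where tail: "\<forall>\<^sub>F N in sequentially.
      (\<Sum>y | y \<in> kr_nodes N \<and> \<bar>X N - y\<bar> > int k. (kr_cd N 0 (M N) (X N) y)\<^sup>2) \<le> \<epsilon>'"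
    using kr_cd_tail[OF c_bounds \<phi> M(1) M1 Xn XX \<epsilon>'] by blast
  have absX: "(\<lambda>N. of_int \<bar>X N\<bar> / real N) \<longlonglongrightarrow> \<bar>u\<bar>"
    using tendsto_rabs[OF X] by simp
  have r1: "(\<lambda>N. (1 + (real k / real N) / (of_int \<bar>X N\<bar> / real N)) ^ (2 * d)) \<longlonglongrightarrow> (1 + 0 / \<bar>u\<bar>) ^ (2 * d)"
    using u by (intro tendsto_intros absX lim_const_over_n) auto
  have r2: "(\<lambda>N. (1 / (of_int \<bar>X N\<bar> / real N)) ^ (2 * d)) \<longlonglongrightarrow> (1 / \<bar>u\<bar>) ^ (2 * d)"
    using u by (intro tendsto_intros absX) auto
  define E where "E N = kr_cd N 0 (M N + d) (X N) (X N) - 2 * kr_cd N 0 (M N) (X N) (X N)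
      + ((1 + (real k / real N) / (of_int \<bar>X N\<bar> / real N)) ^ (2 * d) * kr_cd N 0 (M N) (X N) (X N)
      + (1 / (of_int \<bar>X N\<bar> / real N)) ^ (2 * d) * \<epsilon>')" for N
  have "E \<longlonglongrightarrow> s - 2 * s + ((1 + 0 / \<bar>u\<bar>) ^ (2 * d) * s + (1 / \<bar>u\<bar>) ^ (2 * d) * \<epsilon>')"
    unfolding E_def by (intro tendsto_intros lim1 lim2 r1 r2)
  also have "s - 2 * s + ((1 + 0 / \<bar>u\<bar>) ^ (2 * d) * s + (1 / \<bar>u\<bar>) ^ (2 * d) * \<epsilon>') = \<epsilon>\<^sup>2 / 2"
    using u by (simp add: \<epsilon>'_def power_divide)
  finally have "E \<longlonglongrightarrow> \<epsilon>\<^sup>2 / 2" .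
  then have "\<forall>\<^sub>F N in sequentially. E N < \<epsilon>\<^sup>2"
    using \<epsilon> by (intro order_tendstoD(2)) auto
  moreover have "\<forall>\<^sub>F N in sequentially. of_int \<bar>X N\<bar> / real N > 0"
    using u by (intro order_tendstoD(1)[OF absX]) auto
  ultimately show "\<forall>\<^sub>F N in sequentially.
      dist (kr_cd N d (M N) (X N) (Y N) - kr_cd N 0 (M N + d) (X N) (Y N)) 0 < \<epsilon>"
    using tail M(2) Xn Y eventually_gt_at_top[of 0]
  proof eventually_elim
    case (elim N)
    let ?x = "X N" and ?K = "kr_cd N 0 (M N)"
    define f where "f = (\<lambda>y. (1 / of_int ?x) ^ d * of_int y ^ d * ?K ?x y)"
    have x0: "?x \<noteq> 0" using elim(2) by auto
    have M0: "M N \<le> kr_dim N 0" and Mk: "M N \<le> kr_dim N d" and M': "M N \<le> 2 * N + 1"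
      using elim(4) by (auto simp: kr_dim_def)
    have f: "f \<in> kr_space N d (M N)"
      unfolding f_def by (intro kr_space_mult_power kr_cd_in_kr_space M0)
    have fx: "f ?x = ?K ?x ?x" using x0 by (simp add: f_def power_divide)
    have "kr_ip N f f \<le> (1 + real k / of_int \<bar>?x\<bar>) ^ (2 * d) * ?K ?x ?x +
        (real N / of_int \<bar>?x\<bar>) ^ (2 * d) * (\<Sum>y | y \<in> kr_nodes N \<and> \<bar>?x - y\<bar> > int k. (?K ?x y)\<^sup>2)"
      unfolding f_def by (rule kr_test_function_norm_le[OF M' x0 elim(5)])
    also have "\<dots> \<le> (1 + real k / of_int \<bar>?x\<bar>) ^ (2 * d) * ?K ?x ?x + (real N / of_int \<bar>?x\<bar>) ^ (2 * d) * \<epsilon>'"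
      by (intro add_left_mono mult_left_mono elim(3)) auto
    also have "real k / of_int \<bar>?x\<bar> = (real k / real N) / (of_int \<bar>?x\<bar> / real N)" using elim(7) by simp
    also have "real N / of_int \<bar>?x\<bar> = 1 / (of_int \<bar>?x\<bar> / real N)" by simp
    finally have norm: "kr_cd N 0 (M N + d) ?x ?x - 2 * f ?x + kr_ip N f f \<le> E N"
      unfolding fx E_def by simp
    have "M N + d \<le> 2 * N + 1" using elim(4) by simp
    from kr_cd_comparison[OF Mk this elim(6) f]
    have "(kr_cd N d (M N) ?x (Y N) - kr_cd N 0 (M N + d) ?x (Y N))\<^sup>2 < \<epsilon>\<^sup>2"
      using norm elim(1) by (meson le_less_trans order_trans)
    then have "\<bar>kr_cd N d (M N) ?x (Y N) - kr_cd N 0 (M N + d) ?x (Y N)\<bar> < \<epsilon>"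
      using \<epsilon> by (metis abs_of_pos less_eq_real_def power2_abs power2_less_imp_less)
    then show ?case by (simp add: dist_real_def)
  qed
qed

lemma kr_kernel_tendsto:
  assumes n: "(\<lambda>N. real (2 * n N) / real N) \<longlonglongrightarrow> 1 - c * cos \<phi>" "\<forall>\<^sub>F N in sequentially. 2 * n N + d \<le> 2 * N"
    and X: "(\<lambda>N. of_int (X N) / real N) \<longlonglongrightarrow> u"
  shows "(\<lambda>N. kr_kernel N d (n N) (X N + A) (X N + B)) \<longlonglongrightarrow> discrete_sine_kernel \<phi> A B"
proof -
  let ?M = "\<lambda>N. 2 * n N"
  have XA: "(\<lambda>N. of_int (X N + A) / real N) \<longlonglongrightarrow> u" and XB: "(\<lambda>N. of_int (X N + B) / real N) \<longlonglongrightarrow> u"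
    by (rule of_int_shift_tendsto[OF X])+
  have XB': "(\<lambda>N. of_int (- (X N + B)) / real N) \<longlonglongrightarrow> - u"
    using tendsto_minus[OF XB] by (simp add: minus_divide_left)
  have nodes: "\<forall>\<^sub>F N in sequentially. X N + B \<in> kr_nodes N" by (rule eventually_in_kr_nodes[OF XB u(2)])
  then have nodes': "\<forall>\<^sub>F N in sequentially. - (X N + B) \<in> kr_nodes N" by (auto elim: eventually_mono)
  have M2: "\<forall>\<^sub>F N in sequentially. ?M N + d \<le> 2 * N + 1" using n(2) by (auto elim: eventually_mono)
  have Md: "(\<lambda>N. real (?M N + d) / real N) \<longlonglongrightarrow> 1 - c * cos \<phi>"
    using tendsto_add[OF n(1) lim_const_over_n[of "real d"]] by (simp add: add_divide_distrib)
  have "(\<lambda>N. (kr_cd N d (?M N) (X N + A) (X N + B) - kr_cd N 0 (?M N + d) (X N + A) (X N + B)) +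
      kr_cd N 0 (?M N + d) (X N + A) (X N + B)) \<longlonglongrightarrow> 0 + discrete_sine_kernel \<phi> A B"
    by (intro tendsto_add kr_cd_deformation_negligible n XA nodes kr_cd_bulk Md M2 X)
  then have near: "(\<lambda>N. kr_cd N d (?M N) (X N + A) (X N + B)) \<longlonglongrightarrow> discrete_sine_kernel \<phi> A B" by simp
  have "(\<lambda>N. (kr_cd N d (?M N) (X N + A) (- (X N + B)) - kr_cd N 0 (?M N + d) (X N + A) (- (X N + B))) +
      kr_cd N 0 (?M N + d) (X N + A) (- (X N + B))) \<longlonglongrightarrow> 0 + 0"
    by (intro tendsto_add kr_cd_deformation_negligible n XA nodes' kr_cd_far Md M2 XB')
  then have far: "(\<lambda>N. kr_cd N d (?M N) (X N + A) (- (X N + B))) \<longlonglongrightarrow> 0" by simp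
  have nonzero: "\<forall>\<^sub>F N in sequentially. Z N \<noteq> 0" if "(\<lambda>N. of_int (Z N) / real N) \<longlonglongrightarrow> u" for Z :: "nat \<Rightarrow> int"
    using order_tendstoD(1)[OF tendsto_rabs[OF that] u(1)] by eventually_elim auto
  have "\<forall>\<^sub>F N in sequentially. kr_cd N d (?M N) (X N + A) (X N + B) + (-1) ^ d * kr_cd N d (?M N) (X N + A) (- (X N + B)) =
      kr_kernel N d (n N) (X N + A) (X N + B)"
    using n(2) nonzero[OF XA] nonzero[OF XB] nodes
    by eventually_elim (intro kr_kernel_eq_cd[symmetric], auto simp: kr_dim_def)
  moreover have "(\<lambda>N. kr_cd N d (?M N) (X N + A) (X N + B) + (-1) ^ d * kr_cd N d (?M N) (X N + A) (- (X N + B)))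
      \<longlonglongrightarrow> discrete_sine_kernel \<phi> A B + (-1) ^ d * 0"
    by (intro tendsto_intros near far)
  ultimately show ?thesis using Lim_transform_eventually by fastforce
qed

end

lemma floor_mult_over_tendsto: "(\<lambda>N. of_int \<lfloor>a * real N\<rfloor> / real N) \<longlonglongrightarrow> a"
proof (rule tendsto_sandwich)
  show "(\<lambda>N. a - 1 / real N) \<longlonglongrightarrow> a" using tendsto_diff[OF tendsto_const lim_1_over_n, of a] by simp
  show "\<forall>\<^sub>F N in sequentially. a - 1 / real N \<le> of_int \<lfloor>a * real N\<rfloor> / real N"
    using eventually_gt_at_top[of 0]
  proof eventually_elim
    case (elim N)
    have "(a * real N - 1) / real N \<le> of_int \<lfloor>a * real N\<rfloor> / real N"
      by (intro divide_right_mono) linarith+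
    then show ?case using elim by (simp add: diff_divide_distrib)
  qed
  show "\<forall>\<^sub>F N in sequentially. of_int \<lfloor>a * real N\<rfloor> / real N \<le> a"
    using eventually_gt_at_top[of 0]
  proof eventually_elim
    case (elim N)
    have "of_int \<lfloor>a * real N\<rfloor> / real N \<le> a * real N / real N"
      by (intro divide_right_mono) linarith+
    then show ?case using elim by simp
  qed
qed simp

theorem proposition4p1:
  fixes \<gamma> u :: real and d :: nat and A B :: int
  assumes "0 < \<gamma>" "\<gamma> < 1"
    and "0 < \<bar>u\<bar>" "\<bar>u\<bar> < 2 * sqrt (\<gamma> * (1 - \<gamma>))"
  shows "(\<lambda>N. kr_kernel N d (nat \<lfloor>\<gamma> * real N\<rfloor>)
               (\<lfloor>u * real N\<rfloor> + A) (\<lfloor>u * real N\<rfloor> + B))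
         \<longlonglongrightarrow> discrete_sine_kernel (arccos ((1 - 2 * \<gamma>) / sqrt (1 - u\<^sup>2))) A B"
proof -
  define \<tau> where "\<tau> = (1 - 2 * \<gamma>) / sqrt (1 - u\<^sup>2)"
  have "\<bar>u\<bar>\<^sup>2 < (2 * sqrt (\<gamma> * (1 - \<gamma>)))\<^sup>2"
    using assms by (intro power_strict_mono) auto
  then have u2: "u\<^sup>2 < 1 - (1 - 2 * \<gamma>)\<^sup>2"
    using assms by (simp add: power_mult_distrib) (simp add: power2_eq_square algebra_simps)
  then have "u\<^sup>2 < 1" using zero_le_power2[of "1 - 2 * \<gamma>"] by linarith
  then have u1: "\<bar>u\<bar> < 1" by (simp add: abs_square_less_1)
  have pos: "sqrt (1 - u\<^sup>2) > 0" using \<open>u\<^sup>2 < 1\<close> by simp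
  have "\<bar>1 - 2 * \<gamma>\<bar> < sqrt (1 - u\<^sup>2)"
    using u2 by (intro real_less_rsqrt) simp
  then have \<tau>: "\<bar>\<tau>\<bar> < 1" using pos by (simp add: \<tau>_def abs_divide)
  then have \<tau>': "-1 < \<tau>" "\<tau> < 1" by linarith+
  interpret kr_bulk u "arccos \<tau>"
    using assms(3) u1 arccos_lt_bounded[OF \<tau>'] by unfold_locales auto
  have lim: "1 - c * cos (arccos \<tau>) = 2 * \<gamma>"
    using pos \<tau>' by (simp add: c_def cos_arccos \<tau>_def)
  have nat: "real (nat \<lfloor>\<gamma> * real N\<rfloor>) = of_int \<lfloor>\<gamma> * real N\<rfloor>" for N
    using assms(1) by simp
  have n: "(\<lambda>N. real (2 * nat \<lfloor>\<gamma> * real N\<rfloor>) / real N) \<longlonglongrightarrow> 2 * \<gamma>"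
    using tendsto_mult[OF tendsto_const[of 2] floor_mult_over_tendsto[of \<gamma>]] by (simp add: nat)
  have "(\<lambda>N. real (2 * nat \<lfloor>\<gamma> * real N\<rfloor>) / real N + real d / real N) \<longlonglongrightarrow> 2 * \<gamma> + 0"
    by (intro tendsto_add n lim_const_over_n)
  then have "\<forall>\<^sub>F N in sequentially. real (2 * nat \<lfloor>\<gamma> * real N\<rfloor>) / real N + real d / real N < 2"
    using assms(2) by (intro order_tendstoD(2)) auto
  then have ev: "\<forall>\<^sub>F N in sequentially. 2 * nat \<lfloor>\<gamma> * real N\<rfloor> + d \<le> 2 * N"
    using eventually_gt_at_top[of 0]
  proof eventually_elim
    case (elim N)
    then have "real (2 * nat \<lfloor>\<gamma> * real N\<rfloor> + d) / real N < 2" by (simp add: add_divide_distrib)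
    then have "real (2 * nat \<lfloor>\<gamma> * real N\<rfloor> + d) < real (2 * N)" using elim(2) by (simp add: pos_divide_less_eq)
    then show ?case by linarith
  qed
  show ?thesis
    using kr_kernel_tendsto[OF n[folded lim] ev floor_mult_over_tendsto] by (simp add: \<tau>_def)
qed

end
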